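(* Let $w\in\mathbb{C}$, $z\in\mathbb{C}$ with $\mathrm{Re}(z)>-\frac12$, and $|\arg x|<\frac{\pi}{4}$. Then $$K_{z,w}(x)=\frac{(2x)^{z+\frac12}}{\Gamma\left(z+\frac12\right)}\sum_{n=0}^{\infty}\frac{\left(-\frac{w^2x}{2}\right)^n}{(2n)!}\int_{0}^{\infty}t^{z-\frac12}(t+1)^{z-\frac12}(2t+1)^{-n+\frac12}K_{n+\frac12}(x(2t+1))\;{}_0F_2\left(-;\frac12,\frac12+z;-\frac{w^2x^2t(t+1)}{4}\right)dt.$$
   Context: The generalized modified Bessel function (two subscripts) is defined, for $z,w\in\mathbb{C}$, by $$K_{z,w}(x):=\frac{1}{2\pi i}\int_{c-i\infty}^{c+i\infty}\Gamma\left(\tfrac{s-z}{2}\right)\Gamma\left(\tfrac{s+z}{2}\right)\,{}_1F_1\left(\tfrac{s-z}{2};\tfrac12;-\tfrac{w^2}{4}\right){}_1F_1\left(\tfrac{s+z}{2};\tfrac12;-\tfrac{w^2}{4}\right)2^{s-2}x^{-s}\,ds,$$ where $c=\mathrm{Re}(s)>|\mathrm{Re}(z)|$ and powers of $x$ are principal. Here ${}_1F_1(a;c;u)=\sum_{n\ge0}\frac{(a)_n u^n}{(c)_n n!}$ and ${}_0F_2(-;a,b;u)=\sum_{n\ge0}\frac{u^n}{(a)_n(b)_n n!}$, with $(a)_n=a(a+1)\cdots(a+n-1)$. $K_\nu$ (single subscript) is the modified Bessel function of the second kind. *)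

theory Defs
  imports "HOL-Analysis.Analysis"
begin

definition hyp_1F1 :: "complex \<Rightarrow> complex \<Rightarrow> complex \<Rightarrow> complex" where
  "hyp_1F1 a c u = (\<Sum>n. pochhammer a n * u ^ n / (pochhammer c n * fact n))"

definition hyp_0F2 :: "complex \<Rightarrow> complex \<Rightarrow> complex \<Rightarrow> complex" where
  "hyp_0F2 a b u = (\<Sum>n. u ^ n / (pochhammer a n * pochhammer b n * fact n))"

definition bessel_I :: "complex \<Rightarrow> complex \<Rightarrow> complex" where
  "bessel_I \<nu> y =
     (y / 2) powr \<nu> * (\<Sum>k. (y / 2) ^ (2 * k) * rGamma (of_nat k + \<nu> + 1) / fact k)"

text \<open>
  The modified Bessel function of the second kind; at integer order the usual quotient is
  \<open>0 / 0\<close> and is replaced by its limit in the order. Powers, and hence this function, are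
  principal in the argument; the value at argument \<open>0\<close> is meaningless.
\<close>
definition bessel_K :: "complex \<Rightarrow> complex \<Rightarrow> complex" where
  "bessel_K \<nu> y =
     (let Q = (\<lambda>\<mu>. of_real pi / 2 * (bessel_I (- \<mu>) y - bessel_I \<mu> y) / sin (\<mu> * of_real pi))
      in if \<nu> \<in> \<int> then Lim (at \<nu>) Q else Q \<nu>)"

definition gen_bessel_K_integrand :: "complex \<Rightarrow> complex \<Rightarrow> complex \<Rightarrow> complex \<Rightarrow> complex" where
  "gen_bessel_K_integrand z w x s =
     Gamma ((s - z) / 2) * Gamma ((s + z) / 2)
     * hyp_1F1 ((s - z) / 2) (1 / 2) (- (w\<^sup>2) / 4)
     * hyp_1F1 ((s + z) / 2) (1 / 2) (- (w\<^sup>2) / 4)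
     * 2 powr (s - 2) * x powr (- s)"

text \<open>
  The two-subscript function \<open>K\<^sub>z\<^sub>,\<^sub>w(x)\<close>, with the abscissa \<open>c\<close> of the vertical line of
  integration as an explicit first argument. The line is parametrised by \<open>s = c + \<i> y\<close>, so
  that \<open>ds = \<i> dy\<close>. Only \<open>c > \<bar>Re z\<bar>\<close> is meaningful, and there the value does not depend
  on \<open>c\<close>.
\<close>
definition gen_bessel_K :: "real \<Rightarrow> complex \<Rightarrow> complex \<Rightarrow> complex \<Rightarrow> complex" where
  "gen_bessel_K c z w x =
     1 / (2 * of_real pi * \<i>)
     * (LINT y|lborel. gen_bessel_K_integrand z w x (Complex c y) * \<i>)"

end

theory Submission
  imports Defs "HOL-Probability.Probability" "HOL-Real_Asymp.Real_Asymp"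
begin

text \<open>
  Both sides are equal to the same double series. Put \<open>X = (x / 2)\<^sup>2\<close>, so that \<open>Re X > 0\<close> because
  \<open>\<bar>Arg x\<bar> < pi / 4\<close>, and let \<open>H(X, \<tau>)\<close> be the integral of \<open>exp (- u - X / u) u powr (\<tau> - 1)\<close>
  over the positive half-line, which is essentially the Bessel function \<open>K\<close> of order \<open>\<tau>\<close> at \<open>x\<close>.
  The common value is the sum over \<open>n\<close> and \<open>m\<close> of
  \<open>(- w\<^sup>2) ^ (n + m) / ((2 n)! (2 m)!) * 1/2 * X powr (n - z / 2) * H(X, z + m - n)\<close>.

  On the contour side, each product of Gamma and a confluent function is the series of
  \<open>Gamma (a + n) (- w\<^sup>2) ^ n / (2 n)!\<close>, and the Mellin-Barnes integral of two Gamma functions is \<open>H\<close>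
  (\<open>Mellin_Barnes_macdonald\<close>). That integral reduces to the Cahen-Mellin formula
  (\<open>Cahen_Mellin\<close>), which is proved by Gaussian regularisation. Everything on this side rests on
  Euler's integral along rotated rays (\<open>gamma_integral_complex_rate\<close>), which also gives the
  exponential decay of Gamma that justifies the exchanges of limits (\<open>norm_Gamma_exp_le\<close>).

  On the series side, the index \<open>n\<close> is the one of the outer sum and \<open>m\<close> comes from expanding the
  hypergeometric function. The Bessel function of order \<open>n + 1 / 2\<close> at \<open>x (2 t + 1)\<close> is written
  through \<open>H(X (2 t + 1)\<^sup>2, - n - 1 / 2)\<close> (\<open>bessel_K_half_integer\<close>), and since
  \<open>(2 t + 1)\<^sup>2 = 1 + 4 t (t + 1)\<close>, the substitution \<open>p = t (t + 1)\<close> turns the integral over \<open>t\<close> into a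
  Gamma integral (\<open>macdonald_shifted_square_integral\<close>). Its value again involves \<open>H(X, z + m - n)\<close>.

  Two facts about \<open>H\<close> that are usually obtained by integration by parts and analytic
  continuation, its three-term recurrence and its closed form at order one half, are read off
  from the Mellin-Barnes integral: they are the functional equation and the duplication
  formula of Gamma.
\<close>

section \<open>Measurability, Fubini and substitution\<close>

text \<open>
  The integrals below are taken over product spaces with the indicator of the half-line as
  a factor, so the power function has to be measurable on all of the real line,
  including the branch cut.
\<close>

lemma borel_measurable_of_real_powr [measurable]:
  fixes a :: complex
  assumes [measurable]: "g \<in> borel_measurable M"
  shows "(\<lambda>x. complex_of_real (g x) powr a) \<in> borel_measurable M"
proof -
  have "complex_of_real r powr a = (if r = 0 then 0 else if r > 0 then exp (a * of_real (ln r))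
      else exp (a * (of_real (ln (- r)) + \<i> * of_real pi)))" for r :: real
    using Ln_of_real[of "- r"] Ln_minus[of "of_real (- r)"]
    by (auto simp: powr_def Ln_of_real mult_ac complex_is_Real_iff)
  then show ?thesis
    by (subst measurable_cong, assumption) measurable
qed

lemma Fubini_dominated:
  fixes F :: "real \<Rightarrow> real \<Rightarrow> complex"
  assumes meas: "(\<lambda>(u, t). F u t) \<in> borel_measurable (lborel \<Otimes>\<^sub>M lborel)"
    and A: "integrable lborel A" and B: "integrable lborel B"
    and bound: "\<And>u t. norm (F u t) \<le> A u * B t"
  shows "(LINT t|lborel. LINT u|lborel. F u t) = (LINT u|lborel. LINT t|lborel. F u t)"
proof -
  have AB: "integrable (lborel \<Otimes>\<^sub>M lborel) (\<lambda>(u, t). A u * B t)"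
    using lborel_pair.Fubini_integrable[of "\<lambda>(u, t). A u * B t"] A B
    by (auto simp: borel_measurable_integrable norm_mult integrable_mult_left integrable_norm abs_mult)
  have "integrable (lborel \<Otimes>\<^sub>M lborel) (\<lambda>(u, t). F u t)"
    by (rule Bochner_Integration.integrable_bound[OF AB meas])
      (use bound in \<open>auto simp: split_beta intro!: AE_I2 order_trans[OF bound]\<close>)
  then show ?thesis
    by (rule lborel_pair.Fubini_integral)
qed

text \<open>
  The change of variables for absolutely integrable functions, carried over from the completed
  to the Borel measure.
\<close>

lemma set_lebesgue_borel_substitution:
  fixes f :: "real \<Rightarrow> complex" and g :: "real \<Rightarrow> real"
  assumes S: "S \<in> sets borel" and T: "T \<in> sets borel" and gS: "g ` S = T"
    and f: "(\<lambda>x. indicator T x *\<^sub>R f x) \<in> borel_measurable borel"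
    and fg: "(\<lambda>x. indicator S x *\<^sub>R (h x *\<^sub>R f (g x))) \<in> borel_measurable borel"
    and der: "\<And>x. x \<in> S \<Longrightarrow> (g has_field_derivative h x) (at x)"
    and pos: "\<And>x. x \<in> S \<Longrightarrow> h x \<ge> 0"
    and inj: "inj_on g S"
  shows "set_integrable lborel S (\<lambda>x. h x *\<^sub>R f (g x)) \<longleftrightarrow> set_integrable lborel T f"
    and "(LINT x:S|lborel. h x *\<^sub>R f (g x)) = (LINT x:T|lborel. f x)"
proof -
  have fg': "(\<lambda>x. indicator S x *\<^sub>R (\<bar>h x\<bar> *\<^sub>R f (g x))) = (\<lambda>x. indicator S x *\<^sub>R (h x *\<^sub>R f (g x)))"
    using pos by (auto simp: fun_eq_iff indicator_def)
  have SL: "S \<in> sets lebesgue" using S by simp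
  have 1: "f absolutely_integrable_on T \<longleftrightarrow> (\<lambda>x. \<bar>h x\<bar> *\<^sub>R f (g x)) absolutely_integrable_on S"
    unfolding gS[symmetric]
    by (rule absolutely_integrable_change_of_variables_real[OF SL _ inj])
      (use der in \<open>auto intro: has_field_derivative_at_within\<close>)
  have f1: "set_integrable lborel T f \<longleftrightarrow> f absolutely_integrable_on T"
    unfolding set_integrable_def using f by (subst integrable_completion) simp_all
  have f2: "set_integrable lborel S (\<lambda>x. h x *\<^sub>R f (g x)) \<longleftrightarrow> (\<lambda>x. \<bar>h x\<bar> *\<^sub>R f (g x)) absolutely_integrable_on S"
    unfolding set_integrable_def fg' using fg by (subst integrable_completion) simp_all
  show iff: "set_integrable lborel S (\<lambda>x. h x *\<^sub>R f (g x)) \<longleftrightarrow> set_integrable lborel T f"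
    using 1 f1 f2 by simp
  show "(LINT x:S|lborel. h x *\<^sub>R f (g x)) = (LINT x:T|lborel. f x)"
  proof (cases "set_integrable lborel T f")
    case True
    have "integral S (\<lambda>x. \<bar>h x\<bar> *\<^sub>R f (g x)) = integral (g ` S) f"
      using has_absolute_integral_change_of_variables_real[OF SL _ inj, of h f "integral (g ` S) f"]
        True f1 gS der by (auto intro: has_field_derivative_at_within)
    moreover have "integral S (\<lambda>x. \<bar>h x\<bar> *\<^sub>R f (g x)) = integral S (\<lambda>x. h x *\<^sub>R f (g x))"
      using pos by (intro integral_cong) auto
    ultimately show ?thesis
      using True iff gS by (simp add: set_borel_integral_eq_integral(2))
  next
    case False
    then show ?thesis
      using iff by (simp add: set_lebesgue_integral_def set_integrable_def not_integrable_integral_eq)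
  qed
qed

section \<open>The Gamma integral with complex rate\<close>

text \<open>
  The substitution \<open>q \<mapsto> r q\<close> in Euler's integral.
\<close>

lemma gamma_integral_real_rate:
  fixes s :: complex
  assumes s: "Re s > 0" and r: "r > 0"
  shows "set_integrable lborel {0<..} (\<lambda>q. exp (- of_real (r * q)) * of_real q powr (s - 1))"
    and "(LINT q:{0<..}|lborel. exp (- of_real (r * q)) * of_real q powr (s - 1))
      = Gamma s * of_real r powr (- s)"
proof -
  let ?f = "\<lambda>q. exp (- of_real q) * complex_of_real q powr (s - 1)"
  let ?F = "\<lambda>q. exp (- of_real (r * q)) * complex_of_real q powr (s - 1)"
  have f: "?f = (\<lambda>t. complex_of_real t powr (s - 1) / of_real (exp t))"
    by (simp add: fun_eq_iff exp_minus field_simps exp_of_real)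
  have int: "set_integrable lborel {0<..} ?f"
  proof -
    have "?f absolutely_integrable_on {0<..}"
      using absolutely_integrable_Gamma_integral'[OF s] unfolding f .
    then show ?thesis
      unfolding set_integrable_def by (subst (asm) integrable_completion) measurable
  qed
  have val: "(LINT q:{0<..}|lborel. ?f q) = Gamma s"
    using set_borel_integral_eq_integral(2)[OF int] Gamma_integral_complex'[OF s]
    unfolding f by (simp add: integral_unique)
  have im: "(\<lambda>q. r * q) ` {0<..} = {0<..}"
  proof (intro equalityI subsetI)
    fix y :: real assume "y \<in> {0<..}"
    then show "y \<in> (\<lambda>q. r * q) ` {0<..}" using r by (intro image_eqI[of _ _ "y / r"]) auto
  qed (use r in auto)
  have m1: "(\<lambda>x. indicat_real {0<..} x *\<^sub>R ?f x) \<in> borel_measurable borel"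
    by measurable
  have m2: "(\<lambda>x. indicat_real {0<..} x *\<^sub>R (r *\<^sub>R ?f (r * x))) \<in> borel_measurable borel"
    by measurable
  have der: "((\<lambda>q. r * q) has_field_derivative r) (at x)" for x
    by (auto intro!: derivative_eq_intros)
  have inj: "inj_on (\<lambda>q. r * q) {0<..}" using r by (auto simp: inj_on_def)
  note sub = set_lebesgue_borel_substitution[OF _ _ im m1 m2 der _ inj]
  have eq: "r *\<^sub>R ?f (r * q) = of_real r powr s * ?F q" if "q \<in> {0<..}" for q
    using that r by (simp add: powr_times_real powr_diff scaleR_conv_of_real field_simps)
  have eqs: "?F q = of_real r powr (- s) * (r *\<^sub>R ?f (r * q))" if "q \<in> {0<..}" for q
    unfolding eq[OF that] using r by (simp add: powr_minus)
  have "set_integrable lborel {0<..} (\<lambda>q. of_real r powr (- s) * (r *\<^sub>R ?f (r * q)))"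
    using sub(1) r int by (intro set_integrable_mult_right) auto
  also have "?this \<longleftrightarrow> set_integrable lborel {0<..} ?F"
    by (rule set_integrable_cong) (use eqs in auto)
  finally show "set_integrable lborel {0<..} ?F" .
  have "(LINT q:{0<..}|lborel. ?F q) = (LINT q:{0<..}|lborel. of_real r powr (- s) * (r *\<^sub>R ?f (r * q)))"
    by (rule set_lebesgue_integral_cong) (use eqs in auto)
  also have "\<dots> = of_real r powr (- s) * (LINT q:{0<..}|lborel. r *\<^sub>R ?f (r * q))"
    by (rule set_integral_mult_right)
  also have "(LINT q:{0<..}|lborel. r *\<^sub>R ?f (r * q)) = Gamma s"
    using sub(2) r val by auto
  finally show "(LINT q:{0<..}|lborel. ?F q) = Gamma s * of_real r powr (- s)"
    by (simp add: mult.commute)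
qed


lemma powr_add_of_nat:
  fixes z :: complex
  assumes "z \<noteq> 0"
  shows "z powr (a + of_nat n) = z powr a * z ^ n"
  using assms by (simp add: powr_add)

text \<open>
  Euler's integral along a rotated ray, without contour deformation. The half-plane
  \<open>Re l > 0\<close> is the union of the discs \<open>\<bar>l - r\<bar> < r\<close> with \<open>r > 0\<close>. In such a disc
  \<open>exp (- l q) = exp (- r q) exp ((r - l) q)\<close> may be expanded in powers of \<open>r - l\<close> and
  integrated term by term, since all partial sums are bounded by \<open>exp (- (r - \<bar>r - l\<bar>) q)\<close>;
  the resulting series is the binomial series of \<open>l powr (- s)\<close> around \<open>r\<close>.
\<close>

lemma gamma_integral_complex_rate:
  fixes s l :: complex
  assumes s: "Re s > 0" and l: "Re l > 0"
  shows "set_integrable lborel {0<..} (\<lambda>q. exp (- l * of_real q) * of_real q powr (s - 1))"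
    and "(LINT q:{0<..}|lborel. exp (- l * of_real q) * of_real q powr (s - 1))
      = Gamma s * l powr (- s)"
proof -
  \<comment> \<open>The disc around \<open>r\<close> contains \<open>l\<close> as soon as \<open>2 r Re l > \<bar>l\<bar>\<^sup>2\<close>.\<close>
  define r where "r = (norm l)\<^sup>2 / Re l"
  have l0: "l \<noteq> 0" using l by auto
  have r: "r > 0" unfolding r_def using l l0 by simp
  define d where "d = of_real r - l"
  have "(norm d)\<^sup>2 < r\<^sup>2"
  proof -
    have "(norm d)\<^sup>2 = r\<^sup>2 - 2 * (r * Re l) + (norm l)\<^sup>2"
      unfolding d_def cmod_power2 by (simp add: power2_eq_square algebra_simps)
    also have "r * Re l = (norm l)\<^sup>2" using l by (simp add: r_def)
    also have "r\<^sup>2 - 2 * (norm l)\<^sup>2 + (norm l)\<^sup>2 < r\<^sup>2" using l0 by simp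
    finally show ?thesis .
  qed
  then have dr: "norm d < r"
    using r by (simp add: power2_less_imp_less)
  define e where "e = r - norm d"
  have e: "e > 0" using dr by (simp add: e_def)
  let ?T = "\<lambda>n q. exp (- of_real (r * q)) * of_real q powr (s + of_nat n - 1) * (d ^ n / fact n)"
  let ?F = "\<lambda>q. exp (- l * of_real q) * of_real q powr (s - 1)"
  have Tint: "set_integrable lborel {0<..} (?T n)" for n
    using gamma_integral_real_rate(1)[of "s + of_nat n" r] s r
    by (intro set_integrable_mult_left) (auto simp: add_pos_nonneg)
  have Tval: "(LINT q:{0<..}|lborel. ?T n q) = Gamma (s + of_nat n) * of_real r powr (- (s + of_nat n)) * (d ^ n / fact n)" for n
    using gamma_integral_real_rate(2)[of "s + of_nat n" r] s r
    by (simp add: add_pos_nonneg)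
  have Tsum: "(\<lambda>n. ?T n q) sums ?F q" if q: "q > 0" for q
  proof -
    have "(\<lambda>n. (d * of_real q) ^ n /\<^sub>R fact n) sums exp (d * of_real q)"
      by (rule exp_converges)
    then have "(\<lambda>n. exp (- of_real (r * q)) * of_real q powr (s - 1) * ((d * of_real q) ^ n /\<^sub>R fact n))
        sums (exp (- of_real (r * q)) * of_real q powr (s - 1) * exp (d * of_real q))"
      by (rule sums_mult)
    moreover have "exp (- of_real (r * q)) * of_real q powr (s - 1) * ((d * of_real q) ^ n /\<^sub>R fact n) = ?T n q" for n
    proof -
      have "complex_of_real q powr (s + of_nat n - 1) = of_real q powr (s - 1) * of_real q ^ n"
        using q powr_add_of_nat[of "complex_of_real q" "s - 1" n] by (simp add: algebra_simps)
      then show ?thesis by (simp add: scaleR_conv_of_real field_simps)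
    qed
    moreover have "exp (- of_real (r * q)) * of_real q powr (s - 1) * exp (d * of_real q) = ?F q"
    proof -
      have "exp (- of_real (r * q)) * exp (d * of_real q) = exp (- l * of_real q)"
        by (simp add: d_def exp_add[symmetric] algebra_simps)
      then show ?thesis by (simp add: mult_ac)
    qed
    ultimately show ?thesis by (simp only:)
  qed
  let ?D = "\<lambda>q. norm (exp (- of_real (e * q)) * complex_of_real q powr (s - 1))"
  have "integrable lborel (\<lambda>q. norm (indicator {0<..} q *\<^sub>R
      (exp (- of_real (e * q)) * complex_of_real q powr (s - 1))))"
    using gamma_integral_real_rate(1)[OF s e] unfolding set_integrable_def by (rule integrable_norm)
  then have D: "integrable lborel (\<lambda>q. indicator {0<..} q *\<^sub>R ?D q)"
    by simp
  have bnd: "norm (\<Sum>n<N. ?T n q) \<le> ?D q" if q: "q > 0" for N q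
  proof -
    have "norm (?T n q) = norm (exp (- of_real (r * q)) * complex_of_real q powr (s - 1)) * ((norm d * q) ^ n / fact n)" for n
    proof -
      have "complex_of_real q powr (s + of_nat n - 1) = of_real q powr (s - 1) * of_real q ^ n"
        using q powr_add_of_nat[of "complex_of_real q" "s - 1" n] by (simp add: algebra_simps)
      then show ?thesis using q by (simp add: norm_mult norm_power norm_divide power_mult_distrib)
    qed
    then have "norm (\<Sum>n<N. ?T n q) \<le> (\<Sum>n<N. norm (exp (- of_real (r * q)) * complex_of_real q powr (s - 1)) * ((norm d * q) ^ n / fact n))"
      by (metis (no_types, lifting) norm_sum sum.cong)
    also have "\<dots> = norm (exp (- of_real (r * q)) * complex_of_real q powr (s - 1)) * (\<Sum>n<N. (norm d * q) ^ n / fact n)"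
      by (simp add: sum_distrib_left)
    also have "(\<Sum>n<N. (norm d * q) ^ n / fact n) \<le> exp (norm d * q)"
      using sum_le_suminf[OF summable_exp_generic[of "norm d * q"], of "{..<N}"] q
      by (simp add: exp_def divide_inverse mult.commute)
    also have "norm (exp (- of_real (r * q)) * complex_of_real q powr (s - 1)) * exp (norm d * q) = ?D q"
      by (simp add: norm_mult e_def exp_add[symmetric] algebra_simps norm_exp_eq_Re flip: exp_diff)
    finally show ?thesis by (simp add: mult_left_mono)
  qed
  have lim: "(\<lambda>N. indicator {0<..} q *\<^sub>R (\<Sum>n<N. ?T n q)) \<longlonglongrightarrow> indicator {0<..} q *\<^sub>R ?F q" for q
    using Tsum[of q] by (cases "q > 0") (auto simp: sums_def)
  have m1: "(\<lambda>q. indicator {0<..} q *\<^sub>R ?F q) \<in> borel_measurable lborel"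
    by measurable
  have m2: "(\<lambda>q. indicator {0<..} q *\<^sub>R (\<Sum>n<N. ?T n q)) \<in> borel_measurable lborel" for N
    by measurable
  have nb: "norm (indicator {0<..} q *\<^sub>R (\<Sum>n<N. ?T n q)) \<le> indicator {0<..} q *\<^sub>R ?D q" for N q
    using bnd[of q N] by (cases "q > 0") auto
  show "set_integrable lborel {0<..} ?F"
    unfolding set_integrable_def
    by (rule integrable_dominated_convergence[OF m1 m2 D AE_I2[OF lim] AE_I2[OF nb]])
  have L: "(\<lambda>N. LINT q:{0<..}|lborel. (\<Sum>n<N. ?T n q)) \<longlonglongrightarrow> (LINT q:{0<..}|lborel. ?F q)"
    unfolding set_lebesgue_integral_def
    by (rule integral_dominated_convergence[OF m1 m2 D AE_I2[OF lim] AE_I2[OF nb]])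
  have S: "(LINT q:{0<..}|lborel. (\<Sum>n<N. ?T n q)) = (\<Sum>n<N. LINT q:{0<..}|lborel. ?T n q)" for N
    unfolding set_lebesgue_integral_def scaleR_sum_right
    by (subst Bochner_Integration.integral_sum) (use Tint in \<open>auto simp: set_integrable_def\<close>)
  have "(\<lambda>n. LINT q:{0<..}|lborel. ?T n q) sums (LINT q:{0<..}|lborel. ?F q)"
    using L unfolding S sums_def .
  moreover have "(\<lambda>n. LINT q:{0<..}|lborel. ?T n q) sums (Gamma s * l powr (- s))"
  proof -
    have "norm (- d / of_real r) < 1" using dr r by (simp add: norm_divide)
    from sums_mult[OF gen_binomial_complex[OF this, of "- s"], of "Gamma s * of_real r powr (- s)"]
    have "(\<lambda>n. Gamma s * of_real r powr (- s) * ((- s gchoose n) * (- d / of_real r) ^ n)) sums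
       (Gamma s * of_real r powr (- s) * (1 + - d / of_real r) powr (- s))" .
    moreover have "Gamma s * of_real r powr (- s) * ((- s gchoose n) * (- d / of_real r) ^ n) = (LINT q:{0<..}|lborel. ?T n q)" for n
    proof -
      have nz: "s \<notin> \<int>\<^sub>\<le>\<^sub>0" using s by (auto simp: nonpos_Ints_def)
      have G: "Gamma (s + of_nat n) = pochhammer s n * Gamma s"
        using pochhammer_Gamma[OF nz, of n] Gamma_eq_zero_iff[of s] nz by simp
      have P: "complex_of_real r powr (- (s + of_nat n)) = of_real r powr (- s) / of_real r ^ n"
        using r powr_nat'[of "complex_of_real r" n] by (simp add: powr_diff)
      have "(- d / of_real r) ^ n = (-1) ^ n * (d ^ n / of_real r ^ n)"
        unfolding power_divide power_minus[of d n] by simp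
      moreover have "(- s gchoose n) = (-1) ^ n * pochhammer s n / fact n"
        by (simp add: gbinomial_pochhammer)
      moreover have sq: "(- 1) ^ n * (- 1) ^ n = (1 :: complex)"
        by (simp flip: power_mult_distrib)
      moreover have "Gamma s * of_real r powr (- s) * ((- 1) ^ n * pochhammer s n / fact n * ((- 1) ^ n * (d ^ n / of_real r ^ n)))
          = ((- 1) ^ n * (- 1) ^ n) * (pochhammer s n * Gamma s * (of_real r powr (- s) / of_real r ^ n) * (d ^ n / fact n))"
        by (simp only: divide_inverse mult_ac)
      ultimately show ?thesis
        unfolding Tval G P by (simp only: mult_1)
    qed
    moreover have "of_real r powr (- s) * (1 + - d / of_real r) powr (- s) = l powr (- s)"
    proof -
      have "l = of_real r * (1 + - d / of_real r)" using r by (simp add: d_def field_simps)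
      then show ?thesis using r powr_times_real_left[of "of_real r" "1 + - d / of_real r" "- s"] by simp
    qed
    ultimately show ?thesis by (simp add: mult.assoc)
  qed
  ultimately show "(LINT q:{0<..}|lborel. ?F q) = Gamma s * l powr (- s)"
    by (rule sums_unique2)
qed

text \<open>
  Exponential decay of Gamma on vertical lines, at every rate below \<open>pi / 2\<close> and with an
  explicit constant. It replaces Stirling's formula: in Euler's integral with rate
  \<open>l = exp (i a)\<close> the factor \<open>l powr (- s)\<close> has modulus \<open>exp (a Im s)\<close>, while the integral
  itself is at most the one with the real rate \<open>cos a\<close>. The dependence of the constant on
  \<open>Re s\<close> is mild enough for the later summation over shifts of \<open>s\<close>.
\<close>

lemma norm_Gamma_exp_le:
  assumes s: "Re s > 0" and phi: "0 \<le> phi" "phi < pi / 2"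
  shows "norm (Gamma s) \<le> Gamma (Re s) * cos phi powr (- Re s) * exp (- (phi * \<bar>Im s\<bar>))"
proof -
  \<comment> \<open>The ray is rotated in the direction that makes \<open>a Im s\<close> nonnegative.\<close>
  define a where "a = (if Im s \<ge> 0 then phi else - phi)"
  define l where "l = exp (\<i> * of_real a)"
  have a: "\<bar>a\<bar> < pi / 2" using phi by (auto simp: a_def)
  have c: "cos phi > 0" using phi by (intro cos_gt_zero_pi) auto
  have Rel: "Re l = cos phi" by (auto simp: l_def a_def Re_exp)
  have Lnl: "Ln l = \<i> * of_real a" unfolding l_def using a by (intro Ln_exp) auto
  have "norm (l powr (- s)) = exp (a * Im s)"
    by (simp add: powr_def Lnl) (simp add: l_def)
  also have "a * Im s = phi * \<bar>Im s\<bar>" by (auto simp: a_def)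
  finally have nl: "norm (l powr (- s)) = exp (phi * \<bar>Im s\<bar>)" .
  have Re: "Re (complex_of_real (Re s)) > 0" using s by simp
  have eq: "complex_of_real (norm (exp (- l * of_real q) * of_real q powr (s - 1))) =
      exp (- of_real (cos phi * q)) * of_real q powr (of_real (Re s) - 1)" if "q \<in> {0<..}" for q :: real
  proof -
    have "complex_of_real q powr (of_real (Re s) - 1) = of_real (q powr (Re s - 1))"
      using that powr_of_real[of q "Re s - 1"] by simp
    then show ?thesis
      using that by (simp add: norm_mult Rel norm_powr_real_powr exp_of_real flip: of_real_minus of_real_mult)
  qed
  have le: "norm (Gamma s * l powr (- s)) \<le> (LINT q:{0<..}|lborel. norm (exp (- l * of_real q) * of_real q powr (s - 1)))"
    unfolding gamma_integral_complex_rate(2)[OF s c[folded Rel], symmetric]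
    unfolding set_lebesgue_integral_def
    by (rule order_trans[OF integral_norm_bound]) (simp add: abs_mult)
  have "complex_of_real (LINT q:{0<..}|lborel. norm (exp (- l * of_real q) * of_real q powr (s - 1))) = (LINT q:{0<..}|lborel. exp (- of_real (cos phi * q)) * of_real q powr (of_real (Re s) - 1))"
    unfolding set_integral_complex_of_real[symmetric]
    by (rule set_lebesgue_integral_cong) (use eq in auto)
  also have "\<dots> = Gamma (of_real (Re s)) * of_real (cos phi) powr (- of_real (Re s))"
    by (rule gamma_integral_real_rate(2)[OF Re c])
  also have "\<dots> = of_real (Gamma (Re s) * cos phi powr (- Re s))"
    using powr_of_real[of "cos phi" "- Re s"] c by (simp add: Gamma_complex_of_real)
  finally have "(LINT q:{0<..}|lborel. norm (exp (- l * of_real q) * of_real q powr (s - 1)))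
      = Gamma (Re s) * cos phi powr (- Re s)"
    unfolding of_real_eq_iff .
  with le have "norm (Gamma s) * exp (phi * \<bar>Im s\<bar>) \<le> Gamma (Re s) * cos phi powr (- Re s)"
    by (simp add: norm_mult nl)
  then show ?thesis
    by (simp add: exp_minus field_simps)
qed

lemma integrable_exp_minus_abs:
  assumes "d > 0"
  shows "integrable lborel (\<lambda>y::real. exp (- (d * \<bar>y\<bar>)))"
proof -
  have "integrable lborel (\<lambda>y. norm (indicator {0<..} y *\<^sub>R
      (exp (- complex_of_real (d * y)) * of_real y powr (1 - 1))))"
    using gamma_integral_real_rate(1)[of 1 d] assms
    unfolding set_integrable_def by (intro integrable_norm) simp_all
  also have "(\<lambda>y. norm (indicator {0<..} y *\<^sub>R (exp (- complex_of_real (d * y)) * of_real y powr (1 - 1))))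
      = (\<lambda>y. indicator {0<..} y *\<^sub>R exp (- (d * y)))"
    by (auto simp: fun_eq_iff indicator_def norm_mult)
  finally have 1: "set_integrable lborel {0<..} (\<lambda>y. exp (- (d * y)))"
    unfolding set_integrable_def .
  have 2: "set_integrable lborel {..<0} (\<lambda>y. exp (- (d * (- y))))"
    using lborel_integrable_real_affine[OF 1[unfolded set_integrable_def], of "-1" 0]
    unfolding set_integrable_def
    by (rule_tac Bochner_Integration.integrable_cong[THEN iffD1, rotated 2]) (auto simp: indicator_def)
  have "integrable lborel (\<lambda>y. indicator {0<..} y *\<^sub>R exp (- (d * y)) + indicator {..<0} y *\<^sub>R exp (- (d * (- y))))"
    using 1 2 unfolding set_integrable_def by (rule Bochner_Integration.integrable_add)
  then show ?thesis
  proof (rule Bochner_Integration.integrable_cong_AE_imp)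
    show "AE y in lborel. indicator {0<..} y *\<^sub>R exp (- (d * y)) + indicator {..<0} y *\<^sub>R exp (- (d * (- y))) = exp (- (d * \<bar>y\<bar>))"
      by (rule AE_mp[OF AE_lborel_singleton[of 0]]) (auto simp: indicator_def)
  qed measurable
qed


section \<open>The Cahen-Mellin formula\<close>

lemma not_nonpos_Int_if_Re_pos: "Re s > 0 \<Longrightarrow> s \<notin> \<int>\<^sub>\<le>\<^sub>0"
  by (auto simp: nonpos_Ints_def)

lemma borel_measurable_Gamma_line:
  assumes "Re a > 0"
  shows "(\<lambda>t. Gamma (a + \<i> * of_real t)) \<in> borel_measurable borel"
proof -
  have "isCont (\<lambda>t. Gamma (a + \<i> * of_real t)) t" for t :: real
    using assms by (intro continuous_intros not_nonpos_Int_if_Re_pos) auto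
  then show ?thesis
    by (intro borel_measurable_continuous_onI continuous_at_imp_continuous_on) auto
qed

lemma abs_Arg_less_pi_half: "Re X > 0 \<Longrightarrow> \<bar>Arg X\<bar> < pi / 2"
  using Re_Ln_pos_lt[of X] Arg_eq_Im_Ln[of X] by (cases "X = 0") auto

text \<open>
  \<open>X powr (- s)\<close> grows at rate \<open>\<bar>Arg X\<bar> < pi / 2\<close> along the line. Any decay rate of Gamma strictly
  between \<open>\<bar>Arg X\<bar>\<close> and \<open>pi / 2\<close> beats it; the midpoint is used.
\<close>

lemma Gamma_powr_line_bound:
  assumes a: "Re a > 0" and X: "Re X > 0"
  obtains C d where "d > 0" "C \<ge> 0"
    "\<And>t. norm (Gamma (a + \<i> * of_real t) * X powr (- (a + \<i> * of_real t))) \<le> C * exp (- (d * \<bar>t\<bar>))"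
proof -
  define phi where "phi = (\<bar>Arg X\<bar> + pi / 2) / 2"
  define th where "th = \<bar>Arg X\<bar>"
  have th: "th \<ge> 0" "th < phi" "phi < pi / 2" "phi \<ge> 0"
    using abs_Arg_less_pi_half[OF X] pi_gt_zero by (auto simp: th_def phi_def)
  define G where "G = Gamma (Re a) * cos phi powr (- Re a) * norm X powr (- Re a)"
  have G: "G \<ge> 0" unfolding G_def using a by (intro mult_nonneg_nonneg) (auto intro: Gamma_real_nonneg less_imp_le)
  define C where "C = G * exp ((phi + th) * \<bar>Im a\<bar>)"
  have "norm (Gamma (a + \<i> * of_real t) * X powr (- (a + \<i> * of_real t))) \<le> C * exp (- ((phi - th) * \<bar>t\<bar>))" for t
  proof -
    define y where "y = Im a + t"
    have 1: "norm (Gamma (a + \<i> * of_real t)) \<le> Gamma (Re a) * cos phi powr (- Re a) * exp (- (phi * \<bar>y\<bar>))"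
      using norm_Gamma_exp_le[of "a + \<i> * of_real t" phi] a th by (simp add: y_def)
    have 2: "norm (X powr (- (a + \<i> * of_real t))) = norm X powr (- Re a) * exp (y * Arg X)"
      using norm_powr_complex[of X "- (a + \<i> * of_real t)"] by (simp add: y_def algebra_simps)
    have "y * Arg X \<le> th * \<bar>y\<bar>"
      unfolding th_def by (metis abs_ge_self abs_mult mult.commute)
    then have 3: "norm (X powr (- (a + \<i> * of_real t))) \<le> norm X powr (- Re a) * exp (th * \<bar>y\<bar>)"
      unfolding 2 by (intro mult_left_mono) auto
    have "norm (Gamma (a + \<i> * of_real t) * X powr (- (a + \<i> * of_real t)))
        \<le> (Gamma (Re a) * cos phi powr (- Re a) * exp (- (phi * \<bar>y\<bar>))) * (norm X powr (- Re a) * exp (th * \<bar>y\<bar>))"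
      unfolding norm_mult by (rule mult_mono[OF 1 3]) (auto intro: order_trans[OF norm_ge_zero 1])
    also have "\<dots> = G * exp (- ((phi - th) * \<bar>y\<bar>))"
      by (simp add: G_def algebra_simps flip: exp_add)
    also have "\<dots> \<le> G * exp ((phi + th) * \<bar>Im a\<bar> + - ((phi - th) * \<bar>t\<bar>))"
    proof -
      have "(phi - th) * \<bar>t\<bar> \<le> (phi - th) * (\<bar>y\<bar> + \<bar>Im a\<bar>)"
        using th by (intro mult_left_mono) (auto simp: y_def)
      moreover have "0 \<le> th * \<bar>Im a\<bar>" using th by simp
      ultimately have "- ((phi - th) * \<bar>y\<bar>) \<le> (phi + th) * \<bar>Im a\<bar> + - ((phi - th) * \<bar>t\<bar>)"
        by (simp add: algebra_simps)
      then show ?thesis by (intro mult_left_mono G) simp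
    qed
    finally show ?thesis unfolding C_def exp_add by (simp add: mult.assoc)
  qed
  moreover have "C \<ge> 0" unfolding C_def using G by simp
  ultimately show ?thesis using that[of "phi - th" C] th by auto
qed

text \<open>
  The Fourier transform of a Gaussian of width \<open>k\<close>, rescaled from the characteristic function
  of the standard normal distribution.
\<close>

lemma integral_iexp_gauss:
  fixes v k :: real
  assumes k: "k > 0"
  shows "(LINT t|lborel. exp (\<i> * of_real (t * v)) * of_real (exp (- t\<^sup>2 / (2 * k\<^sup>2))))
    = of_real (k * sqrt (2 * pi) * exp (- (k * v)\<^sup>2 / 2))"
proof -
  have "complex_of_real (exp (- (k * v)\<^sup>2 / 2)) = char std_normal_distribution (k * v)"
    by (simp add: char_std_normal_distribution)
  also have "\<dots> = (LINT x|lborel. std_normal_density x *\<^sub>R iexp (k * v * x))"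
    unfolding char_def by (subst integral_density) auto
  also have "\<dots> = (LINT x|lborel. of_real (1 / sqrt (2 * pi)) * (exp (\<i> * of_real ((0 + k * x) * v)) * of_real (exp (- (0 + k * x)\<^sup>2 / (2 * k\<^sup>2)))))"
    using k by (intro Bochner_Integration.integral_cong)
      (auto simp: std_normal_density_def scaleR_conv_of_real power_mult_distrib mult_ac)
  also have "\<dots> = of_real (1 / sqrt (2 * pi)) * (LINT x|lborel. exp (\<i> * of_real ((0 + k * x) * v)) * of_real (exp (- (0 + k * x)\<^sup>2 / (2 * k\<^sup>2))))"
    by (rule integral_mult_right_zero)
  also have "(LINT x|lborel. exp (\<i> * of_real ((0 + k * x) * v)) * of_real (exp (- (0 + k * x)\<^sup>2 / (2 * k\<^sup>2))))
     = (1 / k) *\<^sub>R (LINT t|lborel. exp (\<i> * of_real (t * v)) * of_real (exp (- t\<^sup>2 / (2 * k\<^sup>2))))"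
    using k lborel_integral_real_affine[of k "\<lambda>t. exp (\<i> * of_real (t * v)) * complex_of_real (exp (- t\<^sup>2 / (2 * k\<^sup>2)))" 0]
    by simp
  finally have "complex_of_real (exp (- (k * v)\<^sup>2 / 2)) = of_real (1 / sqrt (2 * pi)) * ((1 / k) *\<^sub>R (LINT t|lborel. exp (\<i> * of_real (t * v)) * of_real (exp (- t\<^sup>2 / (2 * k\<^sup>2)))))" .
  then show ?thesis
    using k by (simp add: scaleR_conv_of_real field_simps del: of_real_exp)
qed

lemma integrable_gauss:
  assumes "k > 0"
  shows "integrable lborel (\<lambda>t::real. exp (- t\<^sup>2 / (2 * k\<^sup>2)))"
proof -
  have "integrable lborel (\<lambda>t. sqrt (2 * pi * k\<^sup>2) * normal_density 0 k t)"
    using assms by (intro integrable_mult_right) (simp add: integrable_normal_density)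
  then show ?thesis using assms by (simp add: normal_density_def)
qed

lemma integrable_exp_abs_gauss:
  fixes a :: real
  shows "integrable lborel (\<lambda>p::real. exp (a * \<bar>p\<bar> - p\<^sup>2 / 2))"
proof (rule Bochner_Integration.integrable_bound)
  show "integrable lborel (\<lambda>p::real. exp (a\<^sup>2) * exp (- p\<^sup>2 / (2 * (sqrt 2)\<^sup>2)))"
    by (intro integrable_mult_right integrable_gauss) auto
  have "a * \<bar>p\<bar> - p\<^sup>2 / 2 \<le> a\<^sup>2 - p\<^sup>2 / 4" for p
    using zero_le_power2[of "a - \<bar>p\<bar> / 2"] by (simp add: power2_eq_square algebra_simps)
  then show "AE p in lborel. norm (exp (a * \<bar>p\<bar> - p\<^sup>2 / 2)) \<le> norm (exp (a\<^sup>2) * exp (- p\<^sup>2 / (2 * (sqrt 2)\<^sup>2)))"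
    by (simp flip: exp_add)
qed measurable

lemma Gamma_powr_line_integrable:
  assumes a: "Re a > 0" and X: "Re X > 0"
  shows "integrable lborel (\<lambda>t. Gamma (a + \<i> * of_real t) * X powr (- (a + \<i> * of_real t)))"
proof -
  obtain C d where d: "d > 0" and bnd:
    "\<And>t. norm (Gamma (a + \<i> * of_real t) * X powr (- (a + \<i> * of_real t))) \<le> C * exp (- (d * \<bar>t\<bar>))"
    using Gamma_powr_line_bound[OF a X] by metis
  have [measurable]: "(\<lambda>t. Gamma (a + \<i> * of_real t)) \<in> borel_measurable borel"
    by (rule borel_measurable_Gamma_line[OF a])
  have [measurable]: "(\<lambda>t. X powr (- (a + \<i> * of_real t))) \<in> borel_measurable borel"
    unfolding powr_def by measurable
  show ?thesis
  proof (rule Bochner_Integration.integrable_bound)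
    show "integrable lborel (\<lambda>t. C * exp (- (d * \<bar>t\<bar>)))"
      using integrable_exp_minus_abs[OF d] by simp
    show "AE t in lborel. norm (Gamma (a + \<i> * of_real t) * X powr (- (a + \<i> * of_real t))) \<le> norm (C * exp (- (d * \<bar>t\<bar>)))"
      using order_trans[OF bnd abs_ge_self] by (intro AE_I2) (simp only: real_norm_def)
  qed measurable
qed

text \<open>
  The inverse Mellin transform of Gamma regularised by a Gaussian of width \<open>k\<close>. Inserting
  Euler's integral and exchanging the integrals leaves the Fourier transform of the
  Gaussian at \<open>ln q\<close>, a bump of width \<open>1 / k\<close> around \<open>q = 1\<close>; the substitution \<open>q = exp (p / k)\<close>
  rescales that bump to a fixed Gaussian in \<open>p\<close>.
\<close>

lemma gaussian_Cahen_Mellin: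
  assumes a: "Re a > 0" and X: "Re X > 0" and k: "k > 0"
  shows "(LINT t|lborel. Gamma (a + \<i> * of_real t) * X powr (- (a + \<i> * of_real t)) * of_real (exp (- t\<^sup>2 / (2 * k\<^sup>2))))
    = of_real (sqrt (2 * pi)) * (LINT p|lborel. exp (- X * of_real (exp (p / k)) + a * of_real (p / k) - of_real (p\<^sup>2 / 2)))"
proof -
  let ?W = "\<lambda>t. exp (- t\<^sup>2 / (2 * k\<^sup>2))"
  let ?E = "\<lambda>q. exp (- X * of_real q) * complex_of_real q powr (a - 1)"
  let ?F = "\<lambda>q t. indicat_real {0<..} q *\<^sub>R (?E q * exp (\<i> * of_real (t * ln q)) * of_real (?W t))"
  have Eint: "integrable lborel (\<lambda>q. indicat_real {0<..} q *\<^sub>R ?E q)"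
    using gamma_integral_complex_rate(1)[OF a X] unfolding set_integrable_def .
  have "(LINT t|lborel. Gamma (a + \<i> * of_real t) * X powr (- (a + \<i> * of_real t)) * of_real (?W t))
      = (LINT t|lborel. LINT q|lborel. ?F q t)"
  proof (intro Bochner_Integration.integral_cong refl)
    fix t
    have "Gamma (a + \<i> * of_real t) * X powr (- (a + \<i> * of_real t))
        = (LINT q:{0<..}|lborel. exp (- X * of_real q) * of_real q powr (a + \<i> * of_real t - 1))"
      using a X by (subst gamma_integral_complex_rate(2)) auto
    also have "\<dots> = (LINT q:{0<..}|lborel. ?E q * exp (\<i> * of_real (t * ln q)))"
    proof (intro set_lebesgue_integral_cong allI impI)
      fix q :: real assume "q \<in> {0<..}"
      then have "complex_of_real q powr (a + \<i> * of_real t - 1) = of_real q powr (a - 1) * exp (\<i> * of_real (t * ln q))"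
        by (simp add: powr_def Ln_of_real algebra_simps flip: exp_add)
      then show "exp (- X * of_real q) * of_real q powr (a + \<i> * of_real t - 1) = ?E q * exp (\<i> * of_real (t * ln q))"
        by simp
    qed simp
    finally show "Gamma (a + \<i> * of_real t) * X powr (- (a + \<i> * of_real t)) * of_real (?W t) = (LINT q|lborel. ?F q t)"
      by (simp add: set_lebesgue_integral_def flip: integral_mult_left_zero)
  qed
  also have "\<dots> = (LINT q|lborel. LINT t|lborel. ?F q t)"
  proof (rule Fubini_dominated)
    show "integrable lborel (\<lambda>q. norm (indicat_real {0<..} q *\<^sub>R ?E q))"
      using Eint by (rule integrable_norm)
    show "integrable lborel ?W" by (rule integrable_gauss[OF k])
    show "norm (?F q t) \<le> norm (indicat_real {0<..} q *\<^sub>R ?E q) * ?W t" for q t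
      by (simp add: norm_mult)
  qed measurable
  also have "\<dots> = (LINT q:{0<..}|lborel. ?E q * of_real (k * sqrt (2 * pi) * exp (- (k * ln q)\<^sup>2 / 2)))"
    unfolding set_lebesgue_integral_def
  proof (intro Bochner_Integration.integral_cong refl)
    fix q :: real
    have "(LINT t|lborel. ?F q t) = indicat_real {0<..} q *\<^sub>R (?E q * (LINT t|lborel. exp (\<i> * of_real (t * ln q)) * of_real (?W t)))"
      by (simp add: mult.assoc)
    then show "(LINT t|lborel. ?F q t) = indicat_real {0<..} q *\<^sub>R (?E q * of_real (k * sqrt (2 * pi) * exp (- (k * ln q)\<^sup>2 / 2)))"
      unfolding integral_iexp_gauss[OF k] .
  qed
  also have "\<dots> = (LINT p:UNIV|lborel. (exp (p / k) / k) *\<^sub>R (?E (exp (p / k)) * of_real (k * sqrt (2 * pi) * exp (- (k * ln (exp (p / k)))\<^sup>2 / 2))))"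
  proof (rule set_lebesgue_borel_substitution(2)[symmetric])
    show "(\<lambda>p. exp (p / k)) ` UNIV = {0<..}"
    proof (intro equalityI subsetI)
      fix x :: real assume "x \<in> {0<..}"
      then show "x \<in> (\<lambda>p. exp (p / k)) ` UNIV" using k by (intro image_eqI[of _ _ "k * ln x"]) auto
    qed auto
    show "((\<lambda>p. exp (p / k)) has_real_derivative exp (x / k) / k) (at x)" for x
      using k by (auto intro!: derivative_eq_intros)
    show "inj_on (\<lambda>p. exp (p / k)) UNIV" using k by (auto simp: inj_on_def)
  qed (use k in \<open>auto, measurable\<close>)
  also have "\<dots> = (LINT p|lborel. of_real (sqrt (2 * pi)) * exp (- X * of_real (exp (p / k)) + a * of_real (p / k) - of_real (p\<^sup>2 / 2)))"
    unfolding set_lebesgue_integral_def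
  proof (intro Bochner_Integration.integral_cong refl)
    fix p
    have "complex_of_real (exp (p / k)) * of_real (exp (p / k)) powr (a - 1) = exp (a * of_real (p / k))"
      by (simp add: powr_def exp_of_real[symmetric] algebra_simps flip: exp_add of_real_divide)
    then have "complex_of_real (exp (p / k)) * of_real (exp (p / k)) powr (a - 1) * exp (- X * of_real (exp (p / k))) * exp (- of_real (p\<^sup>2 / 2))
       = exp (- X * of_real (exp (p / k)) + a * of_real (p / k) - of_real (p\<^sup>2 / 2))"
      by (simp only: exp_add[symmetric]) (simp add: algebra_simps)
    then show "indicator UNIV p *\<^sub>R ((exp (p / k) / k) *\<^sub>R (?E (exp (p / k)) * of_real (k * sqrt (2 * pi) * exp (- (k * ln (exp (p / k)))\<^sup>2 / 2))))
      = of_real (sqrt (2 * pi)) * exp (- X * of_real (exp (p / k)) + a * of_real (p / k) - of_real (p\<^sup>2 / 2))"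
      using k by (simp add: scaleR_conv_of_real field_simps flip: exp_of_real)
  qed
  also have "\<dots> = of_real (sqrt (2 * pi)) * (LINT p|lborel. exp (- X * of_real (exp (p / k)) + a * of_real (p / k) - of_real (p\<^sup>2 / 2)))"
    by (rule integral_mult_right_zero)
  finally show ?thesis .
qed

text \<open>
  The limit \<open>k \<rightarrow> \<infinity>\<close> of the regularised formula. On the left the weight tends to \<open>1\<close>, on the
  right \<open>exp (p / k)\<close> tends to \<open>1\<close>, so that \<open>exp (- X)\<close> comes out of the integral. A complex \<open>X\<close>
  is covered directly.
\<close>

theorem Cahen_Mellin:
  assumes a: "Re a > 0" and X: "Re X > 0"
  shows "(LINT t|lborel. Gamma (a + \<i> * of_real t) * X powr (- (a + \<i> * of_real t))) = 2 * of_real pi * exp (- X)"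
proof -
  let ?g = "\<lambda>t. Gamma (a + \<i> * of_real t) * X powr (- (a + \<i> * of_real t))"
  let ?W = "\<lambda>j t. exp (- t\<^sup>2 / (2 * (real (Suc j))\<^sup>2))"
  let ?h = "\<lambda>j p. exp (- X * of_real (exp (p / real (Suc j))) + a * of_real (p / real (Suc j)) - of_real (p\<^sup>2 / 2))"
  note gint = Gamma_powr_line_integrable[OF a X]
  have inv: "(\<lambda>j. x / real (Suc j)) \<longlonglongrightarrow> 0" for x
    by real_asymp
  have lim1: "(\<lambda>j. LINT t|lborel. ?g t * of_real (?W j t)) \<longlonglongrightarrow> (LINT t|lborel. ?g t)"
  proof (rule integral_dominated_convergence)
    show "integrable lborel (\<lambda>t. norm (?g t))" using gint by (rule integrable_norm)
    show "?g \<in> borel_measurable lborel" using gint by (rule borel_measurable_integrable)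
    then show "(\<lambda>t. ?g t * of_real (?W j t)) \<in> borel_measurable lborel" for j
      by measurable
    have "(\<lambda>j. ?W j t) \<longlonglongrightarrow> 1" for t
      by real_asymp
    then have "(\<lambda>j. ?g t * of_real (?W j t)) \<longlonglongrightarrow> ?g t * of_real 1" for t
      by (intro tendsto_intros)
    then show "AE t in lborel. (\<lambda>j. ?g t * of_real (?W j t)) \<longlonglongrightarrow> ?g t"
      by simp
    show "AE t in lborel. norm (?g t * of_real (?W j t)) \<le> norm (?g t)" for j
      by (intro AE_I2) (auto simp: norm_mult intro!: mult_left_le)
  qed
  have lim2: "(\<lambda>j. LINT p|lborel. ?h j p) \<longlonglongrightarrow> (LINT p|lborel. exp (- X) * of_real (exp (- p\<^sup>2 / 2)))"
  proof (rule integral_dominated_convergence)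
    show "integrable lborel (\<lambda>p. exp (norm a * \<bar>p\<bar> - p\<^sup>2 / 2))"
      by (rule integrable_exp_abs_gauss)
    have "(\<lambda>j. ?h j p) \<longlonglongrightarrow> exp (- X * of_real (exp 0) + a * of_real 0 - of_real (p\<^sup>2 / 2))" for p
      by (intro tendsto_intros inv)
    moreover have "exp (- X * of_real (exp 0) + a * of_real 0 - of_real (p\<^sup>2 / 2)) = exp (- X) * of_real (exp (- p\<^sup>2 / 2))" for p
      by (simp flip: exp_add exp_of_real)
    ultimately show "AE p in lborel. (\<lambda>j. ?h j p) \<longlonglongrightarrow> exp (- X) * of_real (exp (- p\<^sup>2 / 2))"
      by (intro AE_I2) (simp only:)
    have "norm (?h j p) \<le> exp (norm a * \<bar>p\<bar> - p\<^sup>2 / 2)" for j p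
    proof -
      have "Re a * (p / real (Suc j)) \<le> norm a * \<bar>p\<bar>"
      proof -
        have "\<bar>p / real (Suc j)\<bar> \<le> \<bar>p\<bar>" by (simp add: divide_le_eq mult_le_cancel_left1)
        then have "\<bar>Re a\<bar> * \<bar>p / real (Suc j)\<bar> \<le> norm a * \<bar>p\<bar>"
          by (intro mult_mono abs_Re_le_cmod) auto
        then show ?thesis by (metis abs_le_D1 abs_mult)
      qed
      moreover have "Re X * exp (p / real (Suc j)) \<ge> 0" using X by simp
      ultimately show ?thesis by (simp add: norm_exp_eq_Re)
    qed
    then show "AE p in lborel. norm (?h j p) \<le> exp (norm a * \<bar>p\<bar> - p\<^sup>2 / 2)" for j
      by (intro AE_I2)
  qed measurable
  have gauss: "(LINT p|lborel. complex_of_real (exp (- p\<^sup>2 / 2))) = of_real (sqrt (2 * pi))"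
    using integral_iexp_gauss[of 1 0] by simp
  have "(\<lambda>j. LINT t|lborel. ?g t * of_real (?W j t)) \<longlonglongrightarrow> of_real (sqrt (2 * pi)) * (exp (- X) * of_real (sqrt (2 * pi)))"
    using tendsto_mult_left[OF lim2, of "of_real (sqrt (2 * pi))"] unfolding integral_mult_right_zero gauss
    by (subst gaussian_Cahen_Mellin[OF a X]) simp_all
  then have "(LINT t|lborel. ?g t) = of_real (sqrt (2 * pi)) * (exp (- X) * of_real (sqrt (2 * pi)))"
    by (rule LIMSEQ_unique[OF lim1])
  also have "\<dots> = of_real (sqrt (2 * pi) * sqrt (2 * pi)) * exp (- X)"
    by (simp only: of_real_mult mult_ac)
  also have "\<dots> = 2 * of_real pi * exp (- X)"
    by simp
  finally show ?thesis .
qed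


section \<open>The Mellin-Barnes integral of the Macdonald function\<close>

text \<open>
  Up to the factor \<open>2 X powr (\<tau> / 2)\<close> this is the modified Bessel function of the second kind of
  order \<open>\<tau>\<close> at \<open>2 sqrt X\<close>. The integral over the real half-line converges absolutely if
  \<open>Re X > 0\<close>, which for \<open>X = (y / 2)\<^sup>2\<close> is the sector \<open>\<bar>Arg y\<bar> < pi / 4\<close>.
\<close>

definition macdonald_integral :: "complex \<Rightarrow> complex \<Rightarrow> complex" where
  "macdonald_integral X \<tau> =
     (LINT u:{0<..}|lborel. exp (- of_real u - X / of_real u) * of_real u powr (\<tau> - 1))"

lemma power_le_fact_exp:
  fixes x :: real
  assumes "x \<ge> 0"
  shows "x ^ n \<le> fact n * exp x"
proof -
  have "x ^ n / fact n \<le> (\<Sum>k. x ^ k / fact k)"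
    using sum_le_suminf[OF summable_exp_generic[of x], of "{n}"] assms by (simp add: divide_inverse mult.commute)
  also have "(\<Sum>k. x ^ k / fact k) = exp x"
    by (simp add: exp_def divide_inverse mult.commute)
  finally show ?thesis
    by (simp add: pos_divide_le_eq mult.commute)
qed

lemma macdonald_integrand_integrable:
  fixes k R \<tau> :: real
  assumes k: "k > 0" and R: "R > 0"
  shows "set_integrable lborel {0<..} (\<lambda>u. exp (- (k * u) - R / u) * u powr \<tau>)"
proof -
  \<comment> \<open>Near \<open>0\<close>, \<open>exp (- R / u)\<close> is smaller than any power \<open>u ^ N\<close>, which makes the exponent positive.\<close>
  obtain N :: nat where N: "real N > \<bar>\<tau>\<bar>" using reals_Archimedean2 by blast
  let ?s = "complex_of_real (\<tau> + 1 + real N)"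
  let ?g = "\<lambda>u. norm (indicator {0<..} u *\<^sub>R (exp (- of_real (k * u)) * complex_of_real u powr (?s - 1)))"
  have "integrable lborel ?g"
    using gamma_integral_real_rate(1)[of ?s k] N k unfolding set_integrable_def
    by (intro integrable_norm) auto
  then have g: "integrable lborel (\<lambda>u. fact N / R ^ N * ?g u)"
    by (intro integrable_mult_right)
  show ?thesis
    unfolding set_integrable_def
  proof (rule Bochner_Integration.integrable_bound[OF g])
    have "exp (- (k * u) - R / u) * u powr \<tau> \<le> fact N / R ^ N * (exp (- (k * u)) * u powr (\<tau> + real N))"
      if u: "u > 0" for u
    proof -
      have "1 \<le> fact N * (u / R) ^ N * exp (R / u)"
        using power_le_fact_exp[of "R / u" N] u R by (simp add: power_divide field_simps)
      then have "exp (- (R / u)) \<le> fact N * (u / R) ^ N"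
        by (simp add: exp_minus field_simps)
      then have "exp (- (k * u)) * u powr \<tau> * exp (- (R / u)) \<le> exp (- (k * u)) * u powr \<tau> * (fact N * (u / R) ^ N)"
        by (intro mult_left_mono) auto
      moreover have "exp (- (k * u) - R / u) = exp (- (k * u)) * exp (- (R / u))"
        by (simp flip: exp_add)
      ultimately show ?thesis
        using u by (simp add: powr_add powr_realpow power_divide mult_ac)
    qed
    then show "AE u in lborel. norm (indicat_real {0<..} u *\<^sub>R (exp (- (k * u) - R / u) * u powr \<tau>)) \<le> norm (fact N / R ^ N * ?g u)"
      using R by (intro AE_I2) (auto simp: norm_mult norm_powr_real_powr indicator_def)
  qed measurable
qed

lemma norm_macdonald_integrand:
  assumes "u > 0"
  shows "norm (exp (- of_real u - X / of_real u) * complex_of_real u powr (\<tau> - 1))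
    = exp (- (1 * u) - Re X / u) * u powr (Re \<tau> - 1)"
  using assms by (simp add: norm_mult norm_powr_real_powr)

lemma macdonald_integrable:
  assumes X: "Re X > 0"
  shows "set_integrable lborel {0<..} (\<lambda>u. exp (- of_real u - X / of_real u) * complex_of_real u powr (\<tau> - 1))"
  unfolding set_integrable_def
proof (rule Bochner_Integration.integrable_bound)
  show "integrable lborel (\<lambda>u. indicat_real {0<..} u *\<^sub>R (exp (- (1 * u) - Re X / u) * u powr (Re \<tau> - 1)))"
    using macdonald_integrand_integrable[of 1 "Re X"] X unfolding set_integrable_def by auto
  show "AE u in lborel. norm (indicat_real {0<..} u *\<^sub>R (exp (- of_real u - X / of_real u) * complex_of_real u powr (\<tau> - 1)))
    \<le> norm (indicat_real {0<..} u *\<^sub>R (exp (- (1 * u) - Re X / u) * u powr (Re \<tau> - 1)))"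
    using norm_macdonald_integrand[of _ X \<tau>] by (intro AE_I2) (auto simp: indicator_def)
qed measurable

lemma norm_Gamma_le: "Re s > 0 \<Longrightarrow> norm (Gamma s) \<le> Gamma (Re s)"
  using norm_Gamma_exp_le[of s 0] by simp

lemma Mellin_Barnes_integrable:
  assumes a: "Re a > 0" and b: "Re b > 0" and X: "Re X > 0"
  shows "integrable lborel (\<lambda>t. Gamma (a + \<i> * of_real t) * Gamma (b + \<i> * of_real t) * X powr (- (a + \<i> * of_real t)))"
proof (rule Bochner_Integration.integrable_bound)
  note g = Gamma_powr_line_integrable[OF a X]
  show "integrable lborel (\<lambda>t. Gamma (Re b) *\<^sub>R (Gamma (a + \<i> * of_real t) * X powr (- (a + \<i> * of_real t))))"
    using g by simp
  have [measurable]: "(\<lambda>t. Gamma (b + \<i> * of_real t)) \<in> borel_measurable borel"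
    by (rule borel_measurable_Gamma_line[OF b])
  have [measurable]: "(\<lambda>t. Gamma (a + \<i> * of_real t)) \<in> borel_measurable borel"
    by (rule borel_measurable_Gamma_line[OF a])
  show "(\<lambda>t. Gamma (a + \<i> * of_real t) * Gamma (b + \<i> * of_real t) * X powr (- (a + \<i> * of_real t))) \<in> borel_measurable lborel"
    unfolding powr_def by measurable
  have "norm (Gamma (b + \<i> * of_real t)) \<le> \<bar>Gamma (Re b)\<bar>" for t
    using norm_Gamma_le[of "b + \<i> * of_real t"] b by simp
  then have "norm (Gamma (b + \<i> * of_real t)) * norm (Gamma (a + \<i> * of_real t) * X powr (- (a + \<i> * of_real t)))
    \<le> \<bar>Gamma (Re b)\<bar> * norm (Gamma (a + \<i> * of_real t) * X powr (- (a + \<i> * of_real t)))" for t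
    by (rule mult_right_mono) simp
  then show "AE t in lborel. norm (Gamma (a + \<i> * of_real t) * Gamma (b + \<i> * of_real t) * X powr (- (a + \<i> * of_real t)))
    \<le> norm (Gamma (Re b) *\<^sub>R (Gamma (a + \<i> * of_real t) * X powr (- (a + \<i> * of_real t))))"
    by (intro AE_I2) (simp only: norm_scaleR norm_mult mult_ac)
qed

text \<open>
  Euler's integral for the second Gamma factor and an exchange of integrals leave the inverse
  Mellin transform of the first factor at \<open>X / u\<close>, which is \<open>exp (- X / u)\<close>.
\<close>

theorem Mellin_Barnes_macdonald:
  assumes a: "Re a > 0" and b: "Re b > 0" and X: "Re X > 0"
  shows "(LINT t|lborel. Gamma (a + \<i> * of_real t) * Gamma (b + \<i> * of_real t) * X powr (- (a + \<i> * of_real t)))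
    = 2 * of_real pi * macdonald_integral X (b - a)"
proof -
  let ?g = "\<lambda>t. Gamma (a + \<i> * of_real t) * X powr (- (a + \<i> * of_real t))"
  let ?F = "\<lambda>u t. ?g t * (indicat_real {0<..} u *\<^sub>R (exp (- of_real (1 * u)) * of_real u powr (b + \<i> * of_real t - 1)))"
  let ?A = "\<lambda>u. norm (indicat_real {0<..} u *\<^sub>R (exp (- of_real (1 * u)) * complex_of_real u powr (b - 1)))"
  have X0: "X \<noteq> 0" using X by auto
  have [measurable]: "(\<lambda>t. Gamma (a + \<i> * of_real t)) \<in> borel_measurable borel"
    by (rule borel_measurable_Gamma_line[OF a])
  have [measurable]: "(\<lambda>t. X powr (- (a + \<i> * of_real t))) \<in> borel_measurable borel"
    unfolding powr_def by measurable
  have pw: "indicat_real {0<..} u *\<^sub>R (exp (- of_real (1 * u)) * complex_of_real u powr (b + \<i> * of_real t - 1))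
     = indicat_real {0<..} u *\<^sub>R (exp (- of_real (1 * u)) * complex_of_real u powr (b - 1)) * exp (\<i> * of_real (t * ln u))" for u t
    by (cases "u > 0") (auto simp: powr_def Ln_of_real algebra_simps simp flip: exp_add)
  have "(LINT t|lborel. Gamma (a + \<i> * of_real t) * Gamma (b + \<i> * of_real t) * X powr (- (a + \<i> * of_real t)))
      = (LINT t|lborel. LINT u|lborel. ?F u t)"
  proof (intro Bochner_Integration.integral_cong refl)
    fix t
    have "Gamma (b + \<i> * of_real t) = (LINT u:{0<..}|lborel. exp (- of_real (1 * u)) * of_real u powr (b + \<i> * of_real t - 1))"
      using gamma_integral_real_rate(2)[of "b + \<i> * of_real t" 1] b by simp
    then show "Gamma (a + \<i> * of_real t) * Gamma (b + \<i> * of_real t) * X powr (- (a + \<i> * of_real t)) = (LINT u|lborel. ?F u t)"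
      unfolding integral_mult_right_zero set_lebesgue_integral_def by (simp add: mult_ac)
  qed
  also have "\<dots> = (LINT u|lborel. LINT t|lborel. ?F u t)"
  proof (rule Fubini_dominated)
    show "integrable lborel ?A"
      using gamma_integral_real_rate(1)[of b 1] b unfolding set_integrable_def by (intro integrable_norm) simp
    show "integrable lborel (\<lambda>t. norm (?g t))"
      using Gamma_powr_line_integrable[OF a X] by (rule integrable_norm)
    show "norm (?F u t) \<le> ?A u * norm (?g t)" for u t
      unfolding pw by (simp add: norm_mult)
    show "(\<lambda>(u, t). ?F u t) \<in> borel_measurable (lborel \<Otimes>\<^sub>M lborel)"
      unfolding pw by measurable
  qed
  also have "\<dots> = (LINT u|lborel. 2 * of_real pi * (indicat_real {0<..} u *\<^sub>R (exp (- of_real u - X / of_real u) * of_real u powr (b - a - 1))))"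
  proof (intro Bochner_Integration.integral_cong refl)
    fix u :: real
    show "(LINT t|lborel. ?F u t) = 2 * of_real pi * (indicat_real {0<..} u *\<^sub>R (exp (- of_real u - X / of_real u) * of_real u powr (b - a - 1)))"
    proof (cases "u > 0")
      case True
      have "?F u t = (Gamma (a + \<i> * of_real t) * (X / of_real u) powr (- (a + \<i> * of_real t))) * (exp (- of_real u) * of_real u powr (b - a - 1))" for t
      proof -
        have "X / of_real u = of_real (1 / u) * X" by simp
        then have LX: "Ln (X / of_real u) = Ln X - of_real (ln u)"
          using Ln_times_of_real[of "1 / u" X] Ln_of_real[of "1 / u"] True X0 by (simp add: ln_div)
        have "(X / of_real u) powr (- (a + \<i> * of_real t)) * of_real u powr (b - a - 1) = X powr (- (a + \<i> * of_real t)) * of_real u powr (b + \<i> * of_real t - 1)"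
          using True X0 by (simp add: powr_def LX Ln_of_real flip: exp_add) (simp add: algebra_simps)
        then show ?thesis using True by (simp add: mult_ac)
      qed
      then have "(LINT t|lborel. ?F u t) = (LINT t|lborel. Gamma (a + \<i> * of_real t) * (X / of_real u) powr (- (a + \<i> * of_real t))) * (exp (- of_real u) * of_real u powr (b - a - 1))"
        by simp
      also have "\<dots> = 2 * of_real pi * exp (- (X / of_real u)) * (exp (- of_real u) * of_real u powr (b - a - 1))"
        using True X by (subst Cahen_Mellin[OF a]) auto
      finally have F: "(LINT t|lborel. ?F u t)
          = 2 * of_real pi * exp (- (X / of_real u)) * (exp (- of_real u) * of_real u powr (b - a - 1))" .
      have e: "exp (- of_real u - X / of_real u) = exp (- (X / of_real u)) * exp (- complex_of_real u)"
        by (simp only: exp_add[symmetric]) (simp add: algebra_simps)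
      show ?thesis unfolding F e using True by simp
    qed simp
  qed
  also have "\<dots> = 2 * of_real pi * macdonald_integral X (b - a)"
    unfolding macdonald_integral_def set_lebesgue_integral_def by (rule integral_mult_right_zero)
  finally show ?thesis .
qed

text \<open>
  The recurrence is the functional equation of Gamma seen through the Mellin-Barnes integral:
  raising \<open>b\<close> or \<open>a\<close> by one multiplies the integrand by \<open>b + i t\<close> or \<open>(a + i t) / X\<close>, and
  \<open>(b + i t) - (a + i t) = \<tau>\<close> for \<open>b - a = \<tau>\<close>.
\<close>

theorem macdonald_integral_recurrence:
  assumes X: "Re X > 0"
  shows "macdonald_integral X (\<tau> + 1) = X * macdonald_integral X (\<tau> - 1) + \<tau> * macdonald_integral X \<tau>"
proof -
  \<comment> \<open>Any \<open>a\<close> and \<open>b\<close> in the right half-plane with difference \<open>\<tau>\<close> will do.\<close>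
  define a where "a = complex_of_real (1 + \<bar>Re \<tau>\<bar>)"
  define b where "b = a + \<tau>"
  have a: "Re a > 0" and b: "Re b > 0" by (auto simp: a_def b_def)
  have X0: "X \<noteq> 0" using X by auto
  let ?M = "\<lambda>t. Gamma (a + \<i> * of_real t) * Gamma (b + \<i> * of_real t) * X powr (- (a + \<i> * of_real t))"
  have ab: "Re (a + 1) > 0" "Re (b + 1) > 0" using a b by auto
  have G: "Gamma (c + 1 + \<i> * of_real t) = (c + \<i> * of_real t) * Gamma (c + \<i> * of_real t)" if "Re c > 0" for c t
    using Gamma_plus1[OF not_nonpos_Int_if_Re_pos, of "c + \<i> * of_real t"] that by (simp add: add_ac)
  have P: "X powr (- (a + 1 + \<i> * of_real t)) = X powr (- (a + \<i> * of_real t)) / X" for t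
  proof -
    have "- (a + 1 + \<i> * of_real t) = - (a + \<i> * of_real t) - 1" by simp
    then show ?thesis using X0 by (simp only: powr_diff) simp
  qed
  have 1: "(LINT t|lborel. (b + \<i> * of_real t) * ?M t) = 2 * of_real pi * macdonald_integral X (\<tau> + 1)"
    and int1: "integrable lborel (\<lambda>t. (b + \<i> * of_real t) * ?M t)"
    using Mellin_Barnes_macdonald[OF a ab(2) X] Mellin_Barnes_integrable[OF a ab(2) X]
    unfolding G[OF b] by (simp_all add: b_def mult_ac add_ac)
  have 2: "(LINT t|lborel. (a + \<i> * of_real t) * ?M t) = X * (2 * of_real pi * macdonald_integral X (\<tau> - 1))"
    and int2: "integrable lborel (\<lambda>t. (a + \<i> * of_real t) * ?M t)"
  proof -
    have eq: "(a + \<i> * of_real t) * ?M t = X * (Gamma (a + 1 + \<i> * of_real t) * Gamma (b + \<i> * of_real t) * X powr (- (a + 1 + \<i> * of_real t)))" for t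
      unfolding G[OF a] P using X0 by simp
    show "(LINT t|lborel. (a + \<i> * of_real t) * ?M t) = X * (2 * of_real pi * macdonald_integral X (\<tau> - 1))"
      unfolding eq integral_mult_right_zero Mellin_Barnes_macdonald[OF ab(1) b X] by (simp add: b_def)
    show "integrable lborel (\<lambda>t. (a + \<i> * of_real t) * ?M t)"
      unfolding eq using Mellin_Barnes_integrable[OF ab(1) b X] by (rule integrable_mult_right)
  qed
  have "(LINT t|lborel. (b + \<i> * of_real t) * ?M t) - (LINT t|lborel. (a + \<i> * of_real t) * ?M t) = (LINT t|lborel. (b + \<i> * of_real t) * ?M t - (a + \<i> * of_real t) * ?M t)"
    using int1 int2 by simp
  also have "\<dots> = (LINT t|lborel. \<tau> * ?M t)"
    by (intro Bochner_Integration.integral_cong refl) (simp add: b_def algebra_simps)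
  also have "\<dots> = \<tau> * (2 * of_real pi * macdonald_integral X \<tau>)"
    unfolding integral_mult_right_zero Mellin_Barnes_macdonald[OF a b X] by (simp add: b_def)
  finally have "(2 * of_real pi) * macdonald_integral X (\<tau> + 1) = (2 * of_real pi) * (X * macdonald_integral X (\<tau> - 1) + \<tau> * macdonald_integral X \<tau>)"
    unfolding 1 2 by (simp add: algebra_simps)
  then show ?thesis by (subst (asm) mult_left_cancel) auto
qed

lemma power2_powr:
  fixes v :: complex
  assumes "Re v > 0"
  shows "v\<^sup>2 powr s = v powr (2 * s)"
proof -
  have v0: "v \<noteq> 0" using assms by auto
  have "\<bar>Im (Ln v)\<bar> < pi / 2" using Re_Ln_pos_lt[OF v0] assms by simp
  then have "Ln (exp (2 * Ln v)) = 2 * Ln v" by (intro Ln_exp) auto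
  moreover have "exp (2 * Ln v) = v\<^sup>2" using v0 by (simp add: exp_double)
  ultimately show ?thesis using v0 by (simp add: powr_def mult_ac)
qed

text \<open>
  At order one half the two Gamma factors of the Mellin-Barnes integral combine by Legendre's
  duplication formula into a single one, and the Cahen-Mellin formula applies once more.
\<close>

theorem macdonald_integral_half:
  assumes v: "Re v > 0" and X: "Re (v\<^sup>2) > 0"
  shows "macdonald_integral (v\<^sup>2) (1 / 2) = of_real (sqrt pi) * exp (- (2 * v))"
    and "macdonald_integral (v\<^sup>2) (- 1 / 2) = of_real (sqrt pi) * exp (- (2 * v)) / v"
proof -
  have v0: "v \<noteq> 0" using v by auto
  \<comment> \<open>Legendre's formula with \<open>s = 1 + i t\<close>; the power of two turns \<open>v powr (- 2 s)\<close> into \<open>(2 v) powr (- 2 s)\<close>.\<close>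
  have dup: "Gamma (1 + \<i> * of_real t) * Gamma (3 / 2 + \<i> * of_real t) * v\<^sup>2 powr (- (1 + \<i> * of_real t))
     = 2 * of_real (sqrt pi) * (Gamma (2 + \<i> * of_real (2 * t)) * (2 * v) powr (- (2 + \<i> * of_real (2 * t))))" (is "?L t = ?R t") for t
  proof -
    define s where "s = 1 + \<i> * complex_of_real t"
    have s2: "2 + \<i> * complex_of_real (2 * t) = 2 * s" by (simp add: s_def algebra_simps)
    have "complex_of_real (exp (ln 2)) = 2" by simp
    then have e2: "exp (complex_of_real (ln 2)) = 2" by (simp only: exp_of_real)
    have s32: "3 / 2 + \<i> * of_real t = s + 1 / 2" by (simp add: s_def)
    have leg: "Gamma s * Gamma (s + 1 / 2) = exp ((1 - 2 * s) * of_real (ln 2)) * of_real (sqrt pi) * Gamma (2 * s)"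
      by (intro Gamma_legendre_duplication not_nonpos_Int_if_Re_pos) (auto simp: s_def)
    have "(1 - 2 * s) * of_real (ln 2) = of_real (ln 2) + - (2 * s) * of_real (ln 2)"
      by (simp add: algebra_simps)
    then have e: "exp ((1 - 2 * s) * of_real (ln 2)) = 2 * exp (- (2 * s) * of_real (ln 2))"
      by (simp only: exp_add e2)
    have "(2 * v) powr (- (2 * s)) = exp (- (2 * s) * of_real (ln 2) + - (2 * s) * Ln v)"
      using Ln_times_of_real[of 2 v] Ln_of_real[of 2] v0 by (simp add: powr_def ring_distribs)
    also have "\<dots> = exp (- (2 * s) * of_real (ln 2)) * v\<^sup>2 powr (- s)"
      using power2_powr[OF v, of "- s"] v0 by (simp only: exp_add) (simp add: powr_def)
    finally have p: "(2 * v) powr (- (2 * s)) = exp (- (2 * s) * of_real (ln 2)) * v\<^sup>2 powr (- s)" .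
    show ?thesis
      unfolding s2 s_def[symmetric] s32 leg e p by (simp only: mult_ac)
  qed
  let ?g = "\<lambda>t. Gamma (2 + \<i> * of_real t) * (2 * v) powr (- (2 + \<i> * of_real t))"
  have I: "(LINT t|lborel. ?L t) = 2 * of_real pi * (of_real (sqrt pi) * exp (- (2 * v)))"
  proof -
    have "(LINT t|lborel. ?L t) = 2 * of_real (sqrt pi) * (LINT t|lborel. ?g (0 + 2 * t))"
      unfolding dup by simp
    also have "(LINT t|lborel. ?g (0 + 2 * t)) = (1 / 2) *\<^sub>R (LINT t|lborel. ?g t)"
      using lborel_integral_real_affine[of 2 ?g 0] by simp
    also have "(LINT t|lborel. ?g t) = 2 * of_real pi * exp (- (2 * v))"
      by (rule Cahen_Mellin) (use v in auto)
    finally show ?thesis by (simp add: scaleR_conv_of_real)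
  qed
  have "2 * of_real pi * macdonald_integral (v\<^sup>2) (3 / 2 - 1) = (LINT t|lborel. ?L t)"
    by (rule Mellin_Barnes_macdonald[symmetric]) (use X in auto)
  then show "macdonald_integral (v\<^sup>2) (1 / 2) = of_real (sqrt pi) * exp (- (2 * v))"
    unfolding I by simp
  \<comment> \<open>Exchanging the roles of the two Gamma factors changes the sign of the order.\<close>
  have "2 * of_real pi * macdonald_integral (v\<^sup>2) (1 - 3 / 2)
      = (LINT t|lborel. Gamma (3 / 2 + \<i> * of_real t) * Gamma (1 + \<i> * of_real t) * v\<^sup>2 powr (- (3 / 2 + \<i> * of_real t)))"
    by (rule Mellin_Barnes_macdonald[symmetric]) (use X in auto)
  also have "\<dots> = (LINT t|lborel. ?L t / v)"
  proof (intro Bochner_Integration.integral_cong refl)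
    fix t
    have "2 * - (3 / 2 + \<i> * complex_of_real t) = 2 * - (1 + \<i> * of_real t) - 1"
      by (simp add: algebra_simps)
    then have "v\<^sup>2 powr (- (3 / 2 + \<i> * of_real t)) = v\<^sup>2 powr (- (1 + \<i> * of_real t)) / v"
      unfolding power2_powr[OF v] using v0 by (simp only: powr_diff) simp
    then show "Gamma (3 / 2 + \<i> * of_real t) * Gamma (1 + \<i> * of_real t) * v\<^sup>2 powr (- (3 / 2 + \<i> * of_real t)) = ?L t / v"
      by (simp add: mult_ac)
  qed
  also have "\<dots> = (LINT t|lborel. ?L t) / v" by simp
  finally have "(2 * of_real pi) * macdonald_integral (v\<^sup>2) (- 1 / 2) = (2 * of_real pi) * (of_real (sqrt pi) * exp (- (2 * v)) / v)"
    unfolding I by simp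
  then show "macdonald_integral (v\<^sup>2) (- 1 / 2) = of_real (sqrt pi) * exp (- (2 * v)) / v"
    by (subst (asm) mult_left_cancel) auto
qed


section \<open>The Bessel function K of half-integer order\<close>

lemma bessel_series_summable:
  fixes q \<nu> :: complex
  shows "summable (\<lambda>k. q ^ k * rGamma (of_nat k + \<nu> + 1) / fact k)"
proof -
  obtain N :: nat where N: "real N > 2 * norm q + norm \<nu> + 1"
    using reals_Archimedean2 by blast
  show ?thesis
  proof (rule summable_ratio_test[of "1 / 2" N])
    fix k assume "k \<ge> N"
    then have k: "real k > 2 * norm q + norm \<nu> + 1" using N by linarith
    have "norm (complex_of_nat k + \<nu> + 1) \<ge> norm (complex_of_nat (Suc k)) - norm \<nu>"
      using norm_diff_ineq[of "complex_of_nat (Suc k)" \<nu>] by (simp add: algebra_simps)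
    moreover have "norm (complex_of_nat (Suc k)) = real k + 1"
      by (subst norm_of_nat) simp
    ultimately have g1: "norm (complex_of_nat k + \<nu> + 1) \<ge> 1"
      using k norm_ge_zero[of q] by linarith
    have "rGamma (of_nat k + \<nu> + 1) = (of_nat k + \<nu> + 1) * rGamma (of_nat (Suc k) + \<nu> + 1)"
      using rGamma_plus1[of "of_nat k + \<nu> + 1"] by (simp add: add_ac)
    then have le1: "norm (rGamma (of_nat (Suc k) + \<nu> + 1)) \<le> norm (rGamma (of_nat k + \<nu> + 1))"
      using mult_right_mono[OF g1, of "norm (rGamma (of_nat (Suc k) + \<nu> + 1))"] by (simp add: norm_mult)
    have "norm q * 2 \<le> 1 + real k"
      using k norm_ge_zero[of \<nu>] norm_ge_zero[of q] by linarith
    then have "norm q / real (Suc k) \<le> 1 / 2"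
      by (simp add: field_simps)
    then have "(norm q / real (Suc k)) * norm (rGamma (of_nat (Suc k) + \<nu> + 1)) \<le> 1 / 2 * norm (rGamma (of_nat k + \<nu> + 1))"
      using le1 by (intro mult_mono) auto
    then have "norm q ^ k / fact k * ((norm q / real (Suc k)) * norm (rGamma (of_nat (Suc k) + \<nu> + 1)))
        \<le> norm q ^ k / fact k * (1 / 2 * norm (rGamma (of_nat k + \<nu> + 1)))"
      by (intro mult_left_mono) auto
    then show "norm (q ^ Suc k * rGamma (of_nat (Suc k) + \<nu> + 1) / fact (Suc k))
        \<le> 1 / 2 * norm (q ^ k * rGamma (of_nat k + \<nu> + 1) / fact k)"
      by (simp add: norm_mult norm_divide norm_power mult_ac del: of_nat_Suc)
  qed simp
qed

definition bessel_series :: "complex \<Rightarrow> complex \<Rightarrow> complex" where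
  "bessel_series \<nu> q = (\<Sum>k. q ^ k * rGamma (of_nat k + \<nu> + 1) / fact k)"

lemma bessel_I_eq_series: "bessel_I \<nu> y = (y / 2) powr \<nu> * bessel_series \<nu> ((y / 2)\<^sup>2)"
  by (simp add: bessel_I_def bessel_series_def power_mult)

text \<open>
  The term of index \<open>k\<close> of the left-hand side is \<open>k + \<nu>\<close> times that of the series of order \<open>\<nu>\<close>,
  and \<open>k\<close> times the latter is, after an index shift, \<open>q\<close> times the series of order \<open>\<nu> + 1\<close>.
\<close>

lemma bessel_series_recurrence:
  "bessel_series (\<nu> - 1) q = q * bessel_series (\<nu> + 1) q + \<nu> * bessel_series \<nu> q"
proof -
  let ?T = "\<lambda>\<nu> k. q ^ k * rGamma (of_nat k + \<nu> + 1) / fact k"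
  have S: "?T \<nu> sums bessel_series \<nu> q" for \<nu>
    unfolding bessel_series_def by (rule summable_sums[OF bessel_series_summable])
  have "(\<lambda>k. q * ?T (\<nu> + 1) k) sums (q * bessel_series (\<nu> + 1) q)"
    by (rule sums_mult[OF S])
  moreover have "q * ?T (\<nu> + 1) k = of_nat (Suc k) * ?T \<nu> (Suc k)" for k
  proof -
    have e: "of_nat k + (\<nu> + 1) + 1 = of_nat (Suc k) + \<nu> + 1" by simp
    show ?thesis unfolding e by (simp add: field_simps del: of_nat_Suc)
  qed
  ultimately have "(\<lambda>k. of_nat (Suc k) * ?T \<nu> (Suc k)) sums (q * bessel_series (\<nu> + 1) q)"
    by simp
  then have "(\<lambda>k. of_nat k * ?T \<nu> k) sums (q * bessel_series (\<nu> + 1) q)"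
    using sums_Suc_iff[of "\<lambda>k. of_nat k * ?T \<nu> k" "q * bessel_series (\<nu> + 1) q"] by simp
  from sums_add[OF this sums_mult[OF S, of \<nu> \<nu>]]
  have "(\<lambda>k. of_nat k * ?T \<nu> k + \<nu> * ?T \<nu> k) sums (q * bessel_series (\<nu> + 1) q + \<nu> * bessel_series \<nu> q)" .
  moreover have "of_nat k * ?T \<nu> k + \<nu> * ?T \<nu> k = ?T (\<nu> - 1) k" for k
  proof -
    have "?T (\<nu> - 1) k = q ^ k * ((of_nat k + \<nu>) * rGamma (of_nat k + \<nu> + 1)) / fact k"
      unfolding rGamma_plus1 by simp
    then show ?thesis by (simp add: field_simps)
  qed
  ultimately have "?T (\<nu> - 1) sums (q * bessel_series (\<nu> + 1) q + \<nu> * bessel_series \<nu> q)"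
    by simp
  then show ?thesis using S sums_unique2 by blast
qed

lemma bessel_I_recurrence:
  assumes "y \<noteq> 0"
  shows "bessel_I (\<nu> - 1) y = bessel_I (\<nu> + 1) y + 2 * \<nu> / y * bessel_I \<nu> y"
proof -
  have "bessel_I (\<nu> - 1) y = (y / 2) powr \<nu> / (y / 2) * bessel_series (\<nu> - 1) ((y / 2)\<^sup>2)"
    unfolding bessel_I_eq_series using assms by (simp only: powr_diff) simp
  also have "\<dots> = (y / 2) powr \<nu> * (y / 2) * bessel_series (\<nu> + 1) ((y / 2)\<^sup>2) + 2 * \<nu> / y * ((y / 2) powr \<nu> * bessel_series \<nu> ((y / 2)\<^sup>2))"
    unfolding bessel_series_recurrence using assms by (simp add: field_simps power2_eq_square)
  also have "(y / 2) powr \<nu> * (y / 2) = (y / 2) powr (\<nu> + 1)"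
    using assms by (simp only: powr_add) simp
  finally show ?thesis unfolding bessel_I_eq_series .
qed

lemma bessel_K_nonint:
  assumes "\<nu> \<notin> \<int>"
  shows "bessel_K \<nu> y = of_real pi / 2 * (bessel_I (- \<nu>) y - bessel_I \<nu> y) / sin (\<nu> * of_real pi)"
  using assms by (simp add: bessel_K_def Let_def)

text \<open>
  The sine in the denominator changes sign when the order moves by one, so the recurrence of
  \<open>I\<close> at the orders \<open>\<nu>\<close> and \<open>- \<nu>\<close> passes to \<open>K\<close>.
\<close>

lemma bessel_K_recurrence:
  assumes \<nu>: "\<nu> \<notin> \<int>" and y: "y \<noteq> 0"
  shows "bessel_K (\<nu> + 1) y = bessel_K (\<nu> - 1) y + 2 * \<nu> / y * bessel_K \<nu> y"
proof -
  have n: "\<nu> + 1 \<notin> \<int>" "\<nu> - 1 \<notin> \<int>" using \<nu> by auto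
  define S where "S = sin (\<nu> * of_real pi)"
  have s: "sin ((\<nu> + 1) * of_real pi) = - S" "sin ((\<nu> - 1) * of_real pi) = - S"
    by (simp_all add: S_def distrib_right left_diff_distrib sin_add sin_diff)
  have 1: "bessel_I (\<nu> - 1) y = bessel_I (\<nu> + 1) y + 2 * \<nu> / y * bessel_I \<nu> y"
    by (rule bessel_I_recurrence[OF y])
  have 2: "bessel_I (- (\<nu> + 1)) y = bessel_I (- (\<nu> - 1)) y + 2 * (- \<nu>) / y * bessel_I (- \<nu>) y"
    using bessel_I_recurrence[OF y, of "- \<nu>"] by simp
  show ?thesis
    unfolding bessel_K_nonint[OF \<nu>] bessel_K_nonint[OF n(1)] bessel_K_nonint[OF n(2)] s S_def[symmetric] 1 2
    by (simp add: algebra_simps diff_divide_distrib add_divide_distrib)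
qed

lemma half_not_int: "complex_of_int m + 1 / 2 \<notin> \<int>"
proof
  assume "complex_of_int m + 1 / 2 \<in> \<int>"
  then have "complex_of_int m + 1 / 2 - of_int m \<in> \<int>" by (intro Ints_diff) auto
  then have "(1 / 2 :: complex) \<in> \<int>" by simp
  then obtain k where "(1 / 2 :: complex) = of_int k" by (auto elim: Ints_cases)
  then have "2 * (1 / 2 :: complex) = 2 * of_int k" by (rule arg_cong)
  then have "complex_of_int 1 = of_int (2 * k)" by simp
  then show False by (simp only: of_int_eq_iff) presburger
qed

text \<open>
  The two series of orders \<open>- 1 / 2\<close> and \<open>1 / 2\<close> carry the even and the odd part of the
  exponential series of \<open>- 2 v\<close>; pairing consecutive terms of the latter gives the difference
  without reference to hyperbolic functions.
\<close>

lemma bessel_series_half_diff: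
  "bessel_series (- 1 / 2) (v\<^sup>2) - v * bessel_series (1 / 2) (v\<^sup>2) = exp (- (2 * v)) / of_real (sqrt pi)"
proof -
  let ?T = "\<lambda>\<nu> k. (v\<^sup>2) ^ k * rGamma (of_nat k + \<nu> + 1) / fact k"
  have S: "?T \<nu> sums bessel_series \<nu> (v\<^sup>2)" for \<nu>
    unfolding bessel_series_def by (rule summable_sums[OF bessel_series_summable])
  have "(\<lambda>n. (- (2 * v)) ^ n /\<^sub>R fact n) sums exp (- (2 * v))"
    by (rule exp_converges)
  from sums_divide[OF sums_group[OF this, of 2], of "of_real (sqrt pi)"]
  have E: "(\<lambda>k. (\<Sum>n = k * 2..<k * 2 + 2. (- (2 * v)) ^ n /\<^sub>R fact n) / of_real (sqrt pi)) sums (exp (- (2 * v)) / of_real (sqrt pi))"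
    by simp
  have T: "(\<Sum>n = k * 2..<k * 2 + 2. (- (2 * v)) ^ n /\<^sub>R fact n) / of_real (sqrt pi) = ?T (- 1 / 2) k - v * ?T (1 / 2) k" for k
  proof -
    define r where "r = rGamma (complex_of_nat k + 3 / 2)"
    have r1: "rGamma (complex_of_nat k + 1 / 2) = (of_nat k + 1 / 2) * r"
      using rGamma_plus1[of "complex_of_nat k + 1 / 2"] by (simp add: r_def add_ac)
    have "rGamma (1 / 2 :: complex) = pochhammer (1 / 2) k * rGamma (1 / 2 + of_nat k)"
      by (simp add: pochhammer_rGamma)
    moreover have "rGamma (1 / 2 :: complex) = 1 / of_real (sqrt pi)"
      by (simp add: rGamma_inverse_Gamma Gamma_one_half_complex inverse_eq_divide)
    ultimately have P: "1 / of_real (sqrt pi) = pochhammer (1 / 2) k * ((of_nat k + 1 / 2) * r)"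
      using r1 by (simp add: add.commute)
    have F: "(fact (2 * k) :: complex) = 2 ^ (2 * k) * pochhammer (1 / 2) k * fact k"
      by (rule fact_double)
    have F0: "pochhammer (1 / 2 :: complex) k \<noteq> 0"
      using F by (metis fact_nonzero mult_eq_0_iff)
    have "(\<Sum>n = k * 2..<k * 2 + 2. g n) = g (2 * k) + g (Suc (2 * k))" for g :: "nat \<Rightarrow> complex"
      by (simp add: numeral_2_eq_2 atLeastLessThanSuc mult.commute)
    moreover have "a /\<^sub>R fact n = a / fact n" for a :: complex and n
      by (simp add: scaleR_conv_of_real divide_inverse mult.commute)
    ultimately have "(\<Sum>n = k * 2..<k * 2 + 2. (- (2 * v)) ^ n /\<^sub>R fact n)
        = (- (2 * v)) ^ (2 * k) / fact (2 * k) + (- (2 * v)) ^ Suc (2 * k) / fact (Suc (2 * k))"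
      by (simp only:)
    moreover have "(- (2 * v)) ^ (2 * k) = (2 * v) ^ (2 * k)" "(- (2 * v)) ^ Suc (2 * k) = - ((2 * v) ^ (2 * k) * (2 * v))"
      by simp_all
    moreover have "fact (Suc (2 * k)) = fact (2 * k) * (2 * (of_nat k + 1 / 2) :: complex)"
      by (simp add: fact_Suc algebra_simps)
    ultimately have "(\<Sum>n = k * 2..<k * 2 + 2. (- (2 * v)) ^ n /\<^sub>R fact n)
        = (2 * v) ^ (2 * k) / fact (2 * k) + - ((2 * v) ^ (2 * k) * (2 * v)) / (fact (2 * k) * (2 * (of_nat k + 1 / 2)))"
      by (simp only:)
    then have "(\<Sum>n = k * 2..<k * 2 + 2. (- (2 * v)) ^ n /\<^sub>R fact n) / of_real (sqrt pi)
        = ((2 * v) ^ (2 * k) / fact (2 * k) - (2 * v) ^ (2 * k) * (2 * v) / (fact (2 * k) * (2 * (of_nat k + 1 / 2)))) * (1 / of_real (sqrt pi))"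
      by (simp only: minus_divide_left[symmetric] diff_conv_add_uminus[symmetric] times_divide_eq_right mult_1_right)
    also have "(2 * v) ^ (2 * k) = 2 ^ (2 * k) * (v\<^sup>2) ^ k"
      by (simp add: power_mult_distrib power_mult)
    also have "(2 ^ (2 * k) * (v\<^sup>2) ^ k / fact (2 * k) - 2 ^ (2 * k) * (v\<^sup>2) ^ k * (2 * v) / (fact (2 * k) * (2 * (of_nat k + 1 / 2)))) * (1 / of_real (sqrt pi))
        = (v\<^sup>2) ^ k * ((of_nat k + 1 / 2) * r) / fact k - v * ((v\<^sup>2) ^ k * r / fact k)"
    proof -
      have alg: "(W * V / (W * Q * f) - W * V * (2 * v) / (W * Q * f * (2 * m))) * (Q * (m * r)) = V * (m * r) / f - v * (V * r / f)"
        if "W \<noteq> 0" "Q \<noteq> 0" "f \<noteq> 0" "m \<noteq> 0" for W V Q f m :: complex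
        using that by (simp add: field_simps)
      have "1 / complex_of_real (sqrt pi) \<noteq> 0" by simp
      then have "of_nat k + 1 / 2 \<noteq> (0 :: complex)" unfolding P by auto
      then show ?thesis unfolding P F using F0 by (intro alg) auto
    qed
    also have "\<dots> = ?T (- 1 / 2) k - v * ?T (1 / 2) k"
    proof -
      have "complex_of_nat k + - 1 / 2 + 1 = of_nat k + 1 / 2" "complex_of_nat k + 1 / 2 + 1 = of_nat k + 3 / 2" by simp_all
      then show ?thesis by (simp only: r1 r_def)
    qed
    finally show ?thesis .
  qed
  from E have "(\<lambda>k. ?T (- 1 / 2) k - v * ?T (1 / 2) k) sums (exp (- (2 * v)) / of_real (sqrt pi))"
    unfolding T .
  moreover have "(\<lambda>k. ?T (- 1 / 2) k - v * ?T (1 / 2) k) sums (bessel_series (- 1 / 2) (v\<^sup>2) - v * bessel_series (1 / 2) (v\<^sup>2))"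
    by (intro sums_diff sums_mult S)
  ultimately show ?thesis by (rule sums_unique2[symmetric])
qed

text \<open>
  Both sides satisfy the same three-term recurrence in the order, so it is enough to compare
  them at the orders \<open>- 1 / 2\<close> and \<open>1 / 2\<close>, where both are elementary. In this way the power
  series that defines \<open>K\<close> is linked to its integral representation for complex arguments without
  analytic continuation.
\<close>

theorem bessel_K_half_integer:
  assumes v: "Re y > 0" and X: "Re ((y / 2)\<^sup>2) > 0"
  shows "bessel_K (of_nat n + 1 / 2) y
    = 1 / 2 * (y / 2) powr (of_nat n + 1 / 2) * macdonald_integral ((y / 2)\<^sup>2) (- (of_nat n + 1 / 2))"
proof -
  define v where "v = y / 2"
  have y: "y = 2 * v" by (simp add: v_def)
  have v0: "v \<noteq> 0" and Rev: "Re v > 0" using v by (auto simp: y)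
  have X: "Re (v\<^sup>2) > 0" using X by (simp add: v_def)
  define F where "F = (\<lambda>\<nu>. 1 / 2 * v powr \<nu> * macdonald_integral (v\<^sup>2) (- \<nu>))"
  have Frec: "F (\<nu> + 1) = F (\<nu> - 1) + \<nu> / v * F \<nu>" for \<nu>
  proof -
    have p: "v powr (\<nu> + 1) = v powr \<nu> * v" "v powr (\<nu> - 1) = v powr \<nu> / v"
      using v0 by (simp_all add: powr_add powr_diff)
    have e: "macdonald_integral (v\<^sup>2) (- (\<nu> - 1)) = v\<^sup>2 * macdonald_integral (v\<^sup>2) (- (\<nu> + 1)) - \<nu> * macdonald_integral (v\<^sup>2) (- \<nu>)"
      using macdonald_integral_recurrence[OF X, of "- \<nu>"] by simp
    then show ?thesis unfolding F_def p e using v0 by (simp add: field_simps power2_eq_square)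
  qed
  have half: "sin (1 / 2 * of_real pi) = (1 :: complex)" "sin (- 1 / 2 * of_real pi) = (- 1 :: complex)"
  proof -
    have "sin (complex_of_real (pi / 2)) = 1" by (simp only: sin_of_real sin_pi_half) simp
    then show "sin (1 / 2 * of_real pi) = (1 :: complex)" "sin (- 1 / 2 * of_real pi) = (- 1 :: complex)"
      by simp_all
  qed
  have I: "bessel_I (- 1 / 2) y - bessel_I (1 / 2) y = v powr (- 1 / 2) * exp (- (2 * v)) / of_real (sqrt pi)"
  proof -
    have "v powr (1 / 2) = v powr (- 1 / 2) * v"
      using powr_add[of v "- 1 / 2" 1] v0 by simp
    then have "bessel_I (- 1 / 2) y - bessel_I (1 / 2) y = v powr (- 1 / 2) * (bessel_series (- 1 / 2) (v\<^sup>2) - v * bessel_series (1 / 2) (v\<^sup>2))"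
      unfolding bessel_I_eq_series v_def[symmetric] by (simp add: algebra_simps)
    then show ?thesis unfolding bessel_series_half_diff by simp
  qed
  have pi: "complex_of_real pi = of_real (sqrt pi) * of_real (sqrt pi)"
    by (simp flip: of_real_mult)
  have ints: "(1 / 2 :: complex) \<notin> \<int>" "(- 1 / 2 :: complex) \<notin> \<int>"
    using half_not_int[of 0] half_not_int[of "-1"] by simp_all
  have K1: "bessel_K (1 / 2) y = F (1 / 2)"
  proof -
    have "bessel_K (1 / 2) y = of_real pi / 2 * (bessel_I (- 1 / 2) y - bessel_I (1 / 2) y)"
      unfolding bessel_K_nonint[OF ints(1)] half by simp
    also have "\<dots> = 1 / 2 * v powr (1 / 2) * (of_real (sqrt pi) * exp (- (2 * v)) / v)"
      unfolding I pi using powr_add[of v "- 1 / 2" 1] v0 by simp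
    finally show ?thesis
      unfolding F_def using macdonald_integral_half(2)[OF Rev X] by simp
  qed
  have K0: "bessel_K (- 1 / 2) y = F (- 1 / 2)"
  proof -
    have "bessel_K (- 1 / 2) y = of_real pi / 2 * (bessel_I (- 1 / 2) y - bessel_I (1 / 2) y)"
      unfolding bessel_K_nonint[OF ints(2)] half by (simp add: algebra_simps)
    also have "\<dots> = 1 / 2 * v powr (- 1 / 2) * (of_real (sqrt pi) * exp (- (2 * v)))"
      unfolding I pi by simp
    finally show ?thesis
      unfolding F_def using macdonald_integral_half(1)[OF Rev X] by simp
  qed
  have "bessel_K (of_nat n + 1 / 2) y = F (of_nat n + 1 / 2) \<and> bessel_K (of_nat n - 1 / 2) y = F (of_nat n - 1 / 2)"
  proof (induction n)
    case 0
    then show ?case using K0 K1 by simp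
  next
    case (Suc n)
    have \<nu>: "complex_of_nat n + 1 / 2 \<notin> \<int>" using half_not_int[of "int n"] by simp
    have e: "of_nat (Suc n) + 1 / 2 = complex_of_nat n + 1 / 2 + 1" "of_nat (Suc n) - 1 / 2 = complex_of_nat n + 1 / 2"
       "complex_of_nat n + 1 / 2 - 1 = of_nat n - 1 / 2" by simp_all
    have y0: "y \<noteq> 0" and two: "2 * \<nu> / y = \<nu> / v" for \<nu> using v0 by (auto simp: y)
    have "bessel_K (of_nat n + 1 / 2 + 1) y = F (of_nat n + 1 / 2 + 1)"
      unfolding bessel_K_recurrence[OF \<nu> y0] Frec two e(3) using Suc by simp
    then show ?case using Suc unfolding e by simp
  qed
  then show ?thesis unfolding F_def v_def by simp
qed


section \<open>Integrals over shifted squares\<close>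

text \<open>
  The substitution \<open>p = t (t + 1)\<close>, \<open>dp = (2 t + 1) dt\<close> in Euler's integral. The third part is the
  same formula for the real parts of the parameters; it supplies absolute convergence.
\<close>

lemma gamma_integral_shifted_square:
  fixes l \<mu> :: complex
  assumes l: "Re l > 0" and \<mu>: "Re \<mu> > 0"
  defines "f \<equiv> \<lambda>t::real. (2 * t + 1) *\<^sub>R (exp (- l * of_real (t * (t + 1))) * of_real (t * (t + 1)) powr (\<mu> - 1))"
  shows "set_integrable lborel {0<..} f"
    and "(LINT t:{0<..}|lborel. f t) = Gamma \<mu> * l powr (- \<mu>)"
    and "(LINT t:{0<..}|lborel. norm (f t)) = Gamma (Re \<mu>) * Re l powr (- Re \<mu>)"
proof -
  have im: "(\<lambda>t. t * (t + 1)) ` {0<..} = {0::real<..}"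
  proof (intro equalityI subsetI)
    fix p :: real assume p: "p \<in> {0<..}"
    \<comment> \<open>The positive root of \<open>t\<^sup>2 + t = p\<close>.\<close>
    define t where "t = (sqrt (1 + 4 * p) - 1) / 2"
    have "sqrt (1 + 4 * p) > 1" using p by simp
    then have "t > 0" by (simp add: t_def)
    moreover have "p = t * (t + 1)"
      using p by (simp add: t_def field_simps)
    ultimately show "p \<in> (\<lambda>t. t * (t + 1)) ` {0<..}" by auto
  qed auto
  have der: "((\<lambda>t. t * (t + 1)) has_real_derivative 2 * x + 1) (at x)" for x :: real
    by (auto intro!: derivative_eq_intros)
  have inj: "inj_on (\<lambda>t. t * (t + 1)) {0::real<..}"
  proof (rule inj_onI)
    fix s t :: real assume st: "s \<in> {0<..}" "t \<in> {0<..}" "s * (s + 1) = t * (t + 1)"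
    then have "(s - t) * (s + t + 1) = 0" by (simp add: algebra_simps)
    then show "s = t" using st by auto
  qed
  have sub: "set_integrable lborel {0<..} (\<lambda>t. (2 * t + 1) *\<^sub>R (exp (- l * of_real (t * (t + 1))) * of_real (t * (t + 1)) powr (\<mu> - 1)))
     \<and> (LINT t:{0<..}|lborel. (2 * t + 1) *\<^sub>R (exp (- l * of_real (t * (t + 1))) * of_real (t * (t + 1)) powr (\<mu> - 1))) = Gamma \<mu> * l powr (- \<mu>)"
    if "Re l > 0" "Re \<mu> > 0" for l \<mu>
  proof -
    let ?E = "\<lambda>q. exp (- l * of_real q) * complex_of_real q powr (\<mu> - 1)"
    have m1: "(\<lambda>x. indicat_real {0<..} x *\<^sub>R ?E x) \<in> borel_measurable borel"
      by measurable
    have m2: "(\<lambda>x. indicat_real {0<..} x *\<^sub>R ((2 * x + 1) *\<^sub>R ?E (x * (x + 1)))) \<in> borel_measurable borel"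
      by measurable
    note S = set_lebesgue_borel_substitution[OF _ _ im m1 m2 der _ inj]
    show ?thesis
      using S gamma_integral_complex_rate[OF that(2,1)] by simp
  qed
  show "set_integrable lborel {0<..} f" "(LINT t:{0<..}|lborel. f t) = Gamma \<mu> * l powr (- \<mu>)"
    unfolding f_def using sub[OF l \<mu>] by auto
  have rl: "Re (of_real (Re l)) > 0" "Re (of_real (Re \<mu>)) > 0" using l \<mu> by auto
  have "complex_of_real (LINT t:{0<..}|lborel. norm (f t)) = (LINT t:{0<..}|lborel. of_real (norm (f t)))"
    by (rule set_integral_complex_of_real[symmetric])
  also have "\<dots> = (LINT t:{0<..}|lborel. (2 * t + 1) *\<^sub>R (exp (- of_real (Re l) * of_real (t * (t + 1))) * of_real (t * (t + 1)) powr (of_real (Re \<mu>) - 1)))"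
  proof (intro set_lebesgue_integral_cong allI impI)
    fix t :: real assume "t \<in> {0<..}"
    then have t: "t > 0" "t * (t + 1) > 0" by auto
    have "complex_of_real (t * (t + 1)) powr (of_real (Re \<mu>) - 1) = of_real ((t * (t + 1)) powr (Re \<mu> - 1))"
      using powr_of_real[of "t * (t + 1)" "Re \<mu> - 1"] t by simp
    moreover have "norm (f t) = (2 * t + 1) * (exp (- (Re l * (t * (t + 1)))) * (t * (t + 1)) powr (Re \<mu> - 1))"
      using t norm_powr_real_powr[of "of_real (t * (t + 1))" "\<mu> - 1"] unfolding f_def by (simp add: norm_mult)
    moreover have "exp (- complex_of_real (Re l) * of_real (t * (t + 1))) = of_real (exp (- (Re l * (t * (t + 1)))))"
      by (simp flip: exp_of_real)
    ultimately show "complex_of_real (norm (f t)) = (2 * t + 1) *\<^sub>R (exp (- of_real (Re l) * of_real (t * (t + 1))) * of_real (t * (t + 1)) powr (of_real (Re \<mu>) - 1))"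
      by (simp only: scaleR_conv_of_real of_real_mult)
  qed simp
  also have "\<dots> = Gamma (of_real (Re \<mu>)) * of_real (Re l) powr (- of_real (Re \<mu>))"
    using sub[OF rl] by blast
  also have "\<dots> = of_real (Gamma (Re \<mu>) * Re l powr (- Re \<mu>))"
    using powr_of_real[of "Re l" "- Re \<mu>"] l by (simp add: Gamma_complex_of_real)
  finally show "(LINT t:{0<..}|lborel. norm (f t)) = Gamma (Re \<mu>) * Re l powr (- Re \<mu>)"
    unfolding of_real_eq_iff .
qed

text \<open>
  Since \<open>(2 t + 1)\<^sup>2 = 1 + 4 t (t + 1)\<close>, the kernel \<open>exp (- X (2 t + 1)\<^sup>2 / u)\<close> splits off
  \<open>exp (- X / u)\<close>, and the integral over \<open>t\<close> is a Gamma integral with rate \<open>4 X / u\<close>. It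
  contributes a power of \<open>u\<close> that only shifts the order. The third part is what the summation
  under the integral sign needs.
\<close>

lemma macdonald_shifted_square_integral:
  fixes X \<mu> \<tau> :: complex
  assumes X: "Re X > 0" and \<mu>: "Re \<mu> > 0"
  defines "f \<equiv> \<lambda>t::real. of_real (2 * t + 1) * of_real (t * (t + 1)) powr (\<mu> - 1) * macdonald_integral (X * of_real ((2 * t + 1)\<^sup>2)) \<tau>"
  shows "set_integrable lborel {0<..} f"
    and "(LINT t:{0<..}|lborel. f t) = Gamma \<mu> * (4 * X) powr (- \<mu>) * macdonald_integral X (\<tau> + \<mu>)"
    and "(LINT t:{0<..}|lborel. norm (f t)) \<le> Gamma (Re \<mu>) * (4 * Re X) powr (- Re \<mu>)
      * (LINT u:{0<..}|lborel. exp (- (1 * u) - Re X / u) * u powr (Re \<tau> + Re \<mu> - 1))"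
proof -
  define A where "A = (\<lambda>u::real. indicat_real {0<..} u *\<^sub>R (exp (- of_real u - X / of_real u) * complex_of_real u powr (\<tau> - 1)))"
  define B where "B = (\<lambda>u t::real. indicat_real {0<..} t *\<^sub>R ((2 * t + 1) *\<^sub>R (exp (- (4 * X / of_real u) * of_real (t * (t + 1))) * of_real (t * (t + 1)) powr (\<mu> - 1))))"
  have Bm: "(\<lambda>(u, t). A u * B u t) \<in> borel_measurable (lborel \<Otimes>\<^sub>M lborel)"
    unfolding A_def B_def by measurable
  have B1: "integrable lborel (B u)" and B2: "(LINT t|lborel. B u t) = Gamma \<mu> * (4 * X / of_real u) powr (- \<mu>)"
    and B3: "(LINT t|lborel. norm (B u t)) = Gamma (Re \<mu>) * (4 * Re X / u) powr (- Re \<mu>)" if u: "u > 0" for u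
  proof -
    have l: "Re (4 * X / of_real u) > 0" using X u by simp
    note G = gamma_integral_shifted_square[OF l \<mu>]
    show "integrable lborel (B u)" using G(1) unfolding B_def set_integrable_def .
    show "(LINT t|lborel. B u t) = Gamma \<mu> * (4 * X / of_real u) powr (- \<mu>)"
      using G(2) unfolding B_def set_lebesgue_integral_def .
    have "(LINT t|lborel. norm (B u t)) = Gamma (Re \<mu>) * Re (4 * X / of_real u) powr (- Re \<mu>)"
      using G(3) unfolding B_def set_lebesgue_integral_def norm_scaleR[of "indicat_real _ _"] by simp
    then show "(LINT t|lborel. norm (B u t)) = Gamma (Re \<mu>) * (4 * Re X / u) powr (- Re \<mu>)"
      by simp
  qed
  define c where "c = Gamma (Re \<mu>) * (4 * Re X) powr (- Re \<mu>)"
  have N: "(LINT t|lborel. norm (A u * B u t)) = c * (indicat_real {0<..} u *\<^sub>R (exp (- (1 * u) - Re X / u) * u powr (Re \<tau> + Re \<mu> - 1)))" for u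
  proof (cases "u > 0")
    case True
    have "(LINT t|lborel. norm (A u * B u t)) = norm (A u) * (LINT t|lborel. norm (B u t))"
      by (simp add: norm_mult)
    also have "\<dots> = exp (- (1 * u) - Re X / u) * u powr (Re \<tau> - 1) * (Gamma (Re \<mu>) * (4 * Re X / u) powr (- Re \<mu>))"
      unfolding B3[OF True] A_def using norm_macdonald_integrand[OF True, of X \<tau>] True by simp
    also have "(4 * Re X / u) powr (- Re \<mu>) = (4 * Re X) powr (- Re \<mu>) * u powr Re \<mu>"
      using True X by (simp add: powr_divide powr_minus field_simps)
    also have "exp (- (1 * u) - Re X / u) * u powr (Re \<tau> - 1) * (Gamma (Re \<mu>) * ((4 * Re X) powr (- Re \<mu>) * u powr Re \<mu>))
       = c * (exp (- (1 * u) - Re X / u) * u powr (Re \<tau> + Re \<mu> - 1))"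
      using True by (simp add: c_def powr_add powr_diff)
    finally show ?thesis using True by simp
  qed (simp add: A_def)
  have c: "integrable lborel (\<lambda>u. c * (indicat_real {0<..} u *\<^sub>R (exp (- (1 * u) - Re X / u) * u powr (Re \<tau> + Re \<mu> - 1))))"
    using macdonald_integrand_integrable[of 1 "Re X" "Re \<tau> + Re \<mu> - 1"] X unfolding set_integrable_def by (intro integrable_mult_right) simp
  have int: "integrable (lborel \<Otimes>\<^sub>M lborel) (\<lambda>(u, t). A u * B u t)"
  proof (rule lborel_pair.Fubini_integrable[OF Bm])
    show "integrable lborel (\<lambda>u. LINT t|lborel. norm (case (u, t) of (u, t) \<Rightarrow> A u * B u t))"
      using c by (simp add: N)
    have "integrable lborel (\<lambda>t. A u * B u t)" for u
      by (cases "u > 0") (use B1[of u] in \<open>auto simp: A_def\<close>)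
    then show "AE u in lborel. integrable lborel (\<lambda>t. case (u, t) of (u, t) \<Rightarrow> A u * B u t)"
      by simp
  qed
  have inner: "(LINT u|lborel. A u * B u t) = indicat_real {0<..} t *\<^sub>R f t" for t
  proof -
    have AB: "A u * B u t = indicat_real {0<..} t *\<^sub>R (of_real (2 * t + 1) * of_real (t * (t + 1)) powr (\<mu> - 1)) *
       (indicat_real {0<..} u *\<^sub>R (exp (- of_real u - (X * of_real ((2 * t + 1)\<^sup>2)) / of_real u) * of_real u powr (\<tau> - 1)))" for u
    proof (cases "u > 0")
      case True
      have "- of_real u - (X * of_real ((2 * t + 1)\<^sup>2)) / of_real u = - of_real u - X / of_real u + - (4 * X / of_real u) * complex_of_real (t * (t + 1))"
        using True by (simp add: field_simps power2_eq_square)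
      then have "exp (- of_real u - (X * of_real ((2 * t + 1)\<^sup>2)) / of_real u) = exp (- of_real u - X / of_real u) * exp (- (4 * X / of_real u) * complex_of_real (t * (t + 1)))"
        by (simp only: exp_add)
      then show ?thesis unfolding A_def B_def by (simp only: scaleR_conv_of_real mult_ac)
    qed (simp add: A_def)
    show ?thesis
      unfolding AB integral_mult_right_zero f_def macdonald_integral_def set_lebesgue_integral_def
      by (simp only: mult_scaleR_left)
  qed
  have i2: "integrable (lborel \<Otimes>\<^sub>M lborel) (\<lambda>(u, t). norm (A u * B u t))"
    using integrable_norm[OF int] by (simp add: split_beta')
  have "integrable lborel (\<lambda>t. LINT u|lborel. A u * B u t)"
    by (rule lborel_pair.integrable_snd[OF int])
  then show "set_integrable lborel {0<..} f"
    unfolding inner set_integrable_def .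
  have "(LINT t:{0<..}|lborel. f t) = (LINT t|lborel. LINT u|lborel. A u * B u t)"
    unfolding inner set_lebesgue_integral_def ..
  also have "\<dots> = (LINT u|lborel. LINT t|lborel. A u * B u t)"
    by (rule lborel_pair.Fubini_integral[OF int])
  also have "\<dots> = (LINT u|lborel. Gamma \<mu> * (4 * X) powr (- \<mu>) * (indicat_real {0<..} u *\<^sub>R (exp (- of_real u - X / of_real u) * of_real u powr (\<tau> + \<mu> - 1))))"
  proof (intro Bochner_Integration.integral_cong refl)
    fix u :: real
    show "(LINT t|lborel. A u * B u t) = Gamma \<mu> * (4 * X) powr (- \<mu>) * (indicat_real {0<..} u *\<^sub>R (exp (- of_real u - X / of_real u) * of_real u powr (\<tau> + \<mu> - 1)))"
    proof (cases "u > 0")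
      case True
      have "4 * X / of_real u = of_real (1 / u) * (4 * X)" by simp
      then have "(4 * X / of_real u) powr (- \<mu>) = (4 * X) powr (- \<mu>) * of_real (1 / u) powr (- \<mu>)"
        using powr_times_real_left[of "of_real (1 / u)" "4 * X" "- \<mu>"] True by (simp add: mult.commute)
      also have "complex_of_real (1 / u) powr (- \<mu>) = of_real u powr \<mu>"
        using True Ln_of_real[of "1 / u"] by (simp add: powr_def Ln_of_real ln_div)
      finally have p: "(4 * X / of_real u) powr (- \<mu>) = (4 * X) powr (- \<mu>) * of_real u powr \<mu>" .
      have q: "complex_of_real u powr (\<tau> + \<mu> - 1) = of_real u powr (\<tau> - 1) * of_real u powr \<mu>"
        by (simp add: algebra_simps flip: powr_add)
      have "(LINT t|lborel. A u * B u t) = A u * (Gamma \<mu> * ((4 * X) powr (- \<mu>) * of_real u powr \<mu>))"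
        using B2[OF True] p by simp
      then show ?thesis unfolding q A_def using True by simp
    qed (simp add: A_def)
  qed
  also have "\<dots> = Gamma \<mu> * (4 * X) powr (- \<mu>) * macdonald_integral X (\<tau> + \<mu>)"
    unfolding macdonald_integral_def set_lebesgue_integral_def by (rule integral_mult_right_zero)
  finally show "(LINT t:{0<..}|lborel. f t) = Gamma \<mu> * (4 * X) powr (- \<mu>) * macdonald_integral X (\<tau> + \<mu>)" .
  have "(LINT t:{0<..}|lborel. norm (f t)) = (LINT t|lborel. norm (LINT u|lborel. A u * B u t))"
    unfolding inner set_lebesgue_integral_def by simp
  also have "\<dots> \<le> (LINT t|lborel. LINT u|lborel. norm (A u * B u t))"
    by (intro integral_mono integrable_norm lborel_pair.integrable_snd[OF int] lborel_pair.integrable_snd[OF i2] integral_norm_bound)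
  also have "\<dots> = (LINT u|lborel. LINT t|lborel. norm (A u * B u t))"
    by (rule lborel_pair.Fubini_integral[OF i2])
  also have "\<dots> = c * (LINT u:{0<..}|lborel. exp (- (1 * u) - Re X / u) * u powr (Re \<tau> + Re \<mu> - 1))"
    unfolding N set_lebesgue_integral_def by (rule integral_mult_right_zero)
  finally show "(LINT t:{0<..}|lborel. norm (f t)) \<le> Gamma (Re \<mu>) * (4 * Re X) powr (- Re \<mu>)
      * (LINT u:{0<..}|lborel. exp (- (1 * u) - Re X / u) * u powr (Re \<tau> + Re \<mu> - 1))"
    unfolding c_def .
qed

text \<open>
  Half of the exponential decay is given up for the moment: \<open>u ^ m \<le> m! 2 ^ m exp (u / 2)\<close>. The
  growth in \<open>m\<close> is then explicit and is absorbed by the factor \<open>1 / (2 m)!\<close> of the series.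
\<close>

lemma macdonald_real_moment_bound:
  fixes R \<tau> :: real
  assumes R: "R > 0"
  shows "(LINT u:{0<..}|lborel. exp (- (1 * u) - R / u) * u powr (\<tau> + real m))
    \<le> fact m * 2 ^ m * (LINT u:{0<..}|lborel. exp (- ((1 / 2) * u) - R / u) * u powr \<tau>)"
proof -
  have "(LINT u:{0<..}|lborel. exp (- (1 * u) - R / u) * u powr (\<tau> + real m))
    \<le> (LINT u:{0<..}|lborel. fact m * 2 ^ m * (exp (- ((1 / 2) * u) - R / u) * u powr \<tau>))"
  proof (rule set_integral_mono)
    show "set_integrable lborel {0<..} (\<lambda>u. exp (- (1 * u) - R / u) * u powr (\<tau> + real m))"
      by (rule macdonald_integrand_integrable) (use R in auto)
    show "set_integrable lborel {0<..} (\<lambda>u. fact m * 2 ^ m * (exp (- ((1 / 2) * u) - R / u) * u powr \<tau>))"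
      by (intro set_integrable_mult_right macdonald_integrand_integrable) (use R in auto)
    fix u :: real assume "u \<in> {0<..}"
    then have u: "u > 0" by simp
    have "(u / 2) ^ m \<le> fact m * exp (u / 2)" using power_le_fact_exp[of "u / 2" m] u by simp
    then have "u ^ m \<le> fact m * 2 ^ m * exp (u / 2)" by (simp add: power_divide field_simps)
    then have "exp (- (1 * u) - R / u) * u powr \<tau> * u ^ m \<le> exp (- (1 * u) - R / u) * u powr \<tau> * (fact m * 2 ^ m * exp (u / 2))"
      by (intro mult_left_mono) auto
    also have "\<dots> = fact m * 2 ^ m * ((exp (- (1 * u) - R / u) * exp (u / 2)) * u powr \<tau>)" by (simp only: mult_ac)
    also have "exp (- (1 * u) - R / u) * exp (u / 2) = exp (- ((1 / 2) * u) - R / u)"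
      by (simp only: exp_add[symmetric]) simp
    finally show "exp (- (1 * u) - R / u) * u powr (\<tau> + real m) \<le> fact m * 2 ^ m * (exp (- ((1 / 2) * u) - R / u) * u powr \<tau>)"
      using u by (simp add: powr_add powr_realpow mult.assoc)
  qed
  then show ?thesis by simp
qed

section \<open>The double series of the generalized Bessel function\<close>

lemma sums_integral_dominated:
  fixes F :: "nat \<Rightarrow> real \<Rightarrow> complex"
  assumes meas: "\<And>n. F n \<in> borel_measurable lborel"
    and D: "integrable lborel D" and P: "summable P"
    and bound: "\<And>n y. norm (F n y) \<le> P n * D y"
  shows "integrable lborel (\<lambda>y. \<Sum>n. F n y)"
    and "(\<lambda>n. LINT y|lborel. F n y) sums (LINT y|lborel. (\<Sum>n. F n y))"
proof -
  have i: "integrable lborel (F n)" for n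
    by (rule Bochner_Integration.integrable_bound[OF integrable_mult_right[OF D, of "P n"] meas])
      (use order_trans[OF bound abs_ge_self] in \<open>auto intro!: AE_I2\<close>)
  have s1: "summable (\<lambda>n. norm (F n y))" for y
    by (rule summable_comparison_test'[OF summable_mult2[OF P, of "D y"], of 0]) (use bound in auto)
  have "norm (LINT y|lborel. norm (F n y)) \<le> P n * (LINT y|lborel. D y)" for n
  proof -
    have "(LINT y|lborel. norm (F n y)) \<le> (LINT y|lborel. P n * D y)"
      by (intro integral_mono integrable_norm i integrable_mult_right D bound)
    then show ?thesis by simp
  qed
  then have s2: "summable (\<lambda>n. LINT y|lborel. norm (F n y))"
    by (intro summable_comparison_test'[OF summable_mult2[OF P, of "LINT y|lborel. D y"], of 0])
  show "integrable lborel (\<lambda>y. \<Sum>n. F n y)"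
    by (rule integrable_suminf[OF i AE_I2[OF s1] s2])
  show "(\<lambda>n. LINT y|lborel. F n y) sums (LINT y|lborel. (\<Sum>n. F n y))"
    by (rule sums_integral[OF i AE_I2[OF s1] s2])
qed


lemma summable_Gamma_over_fact_double:
  fixes b q :: real
  assumes b: "b > 0" and q: "q \<ge> 0"
  shows "summable (\<lambda>n. q ^ n * Gamma (b + real n) / fact (2 * n))"
proof -
  obtain N :: nat where N: "real N > b + q" using reals_Archimedean2 by blast
  show ?thesis
  proof (rule summable_ratio_test[of "1 / 2" N])
    fix n assume "n \<ge> N"
    then have n: "real n > b + q" using N by linarith
    have G0: "Gamma (b + real n) > 0" using b by (intro Gamma_real_pos) simp
    have "Gamma (b + real (Suc n)) = (b + real n) * Gamma (b + real n)"
      using Gamma_plus1[of "b + real n"] b by (simp add: add_ac not_nonpos_Int_if_Re_pos nonpos_Ints_def) 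
    then have step: "q ^ Suc n * Gamma (b + real (Suc n)) / fact (2 * Suc n)
        = (q * (b + real n) / ((2 * real n + 2) * (2 * real n + 1))) * (q ^ n * Gamma (b + real n) / fact (2 * n))"
      by (simp add: fact_Suc field_simps)
    have "q * (b + real n) \<le> real n * (2 * real n)"
      using n b q by (intro mult_mono) auto
    also have "\<dots> \<le> 1 / 2 * ((2 * real n + 2) * (2 * real n + 1))"
      by (simp add: algebra_simps)
    finally have "q * (b + real n) / ((2 * real n + 2) * (2 * real n + 1)) \<le> 1 / 2"
      by (simp add: pos_divide_le_eq)
    then have "(q * (b + real n) / ((2 * real n + 2) * (2 * real n + 1))) * (q ^ n * Gamma (b + real n) / fact (2 * n))
        \<le> 1 / 2 * (q ^ n * Gamma (b + real n) / fact (2 * n))"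
      using G0 q by (intro mult_right_mono) auto
    moreover have "q ^ n * Gamma (b + real n) / fact (2 * n) \<ge> 0"
      using G0 q by (intro divide_nonneg_nonneg mult_nonneg_nonneg) auto
    moreover have "(q * (b + real n) / ((2 * real n + 2) * (2 * real n + 1))) * (q ^ n * Gamma (b + real n) / fact (2 * n)) \<ge> 0"
      using G0 q b by (intro mult_nonneg_nonneg divide_nonneg_nonneg) auto
    ultimately show "norm (q ^ Suc n * Gamma (b + real (Suc n)) / fact (2 * Suc n))
        \<le> 1 / 2 * norm (q ^ n * Gamma (b + real n) / fact (2 * n))"
      unfolding step by (simp only: real_norm_def abs_of_nonneg)
  qed simp
qed

text \<open>
  The terms of the expansion of \<open>Gamma a\<close> times the confluent function with lower parameter
  \<open>1 / 2\<close> at \<open>- w\<^sup>2 / 4\<close>; the Gamma factor absorbs the rising factorial, and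
  \<open>(1 / 2)\<^sub>n n! 4 ^ n = (2 n)!\<close>.
\<close>

definition gamma_1F1_term :: "complex \<Rightarrow> complex \<Rightarrow> nat \<Rightarrow> complex" where
  "gamma_1F1_term w a n = (- (w\<^sup>2)) ^ n / fact (2 * n) * Gamma (a + of_nat n)"

text \<open>
  The decay rate \<open>pi / 4\<close> is chosen because two such factors together decay at rate \<open>pi / 2\<close>, which
  is more than the growth of \<open>X powr (- s)\<close> for every \<open>X\<close> in the right half-plane.
\<close>

lemma gamma_1F1_term_bound:
  assumes a: "Re a > 0"
  obtains P where "summable P" "\<And>n. P n \<ge> 0"
    "\<And>n t. norm (gamma_1F1_term w (a + \<i> * of_real t) n) \<le> P n * exp (- (pi / 4 * \<bar>t\<bar>))"
proof
  define k where "k = cos (pi / 4)"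
  have k: "k > 0" by (simp add: k_def cos_45)
  define K where "K = k powr (- Re a) * exp (pi / 4 * \<bar>Im a\<bar>)"
  define P where "P = (\<lambda>n. K * ((norm (w\<^sup>2) / k) ^ n * Gamma (Re a + real n) / fact (2 * n)))"
  show "summable P"
    unfolding P_def using k a by (intro summable_mult summable_Gamma_over_fact_double) auto
  show "P n \<ge> 0" for n
    unfolding P_def K_def using k a by (intro mult_nonneg_nonneg divide_nonneg_nonneg) (auto intro!: less_imp_le Gamma_real_pos)
  show "norm (gamma_1F1_term w (a + \<i> * of_real t) n) \<le> P n * exp (- (pi / 4 * \<bar>t\<bar>))" for n t
  proof -
    have "norm (Gamma (a + \<i> * of_real t + of_nat n)) \<le> Gamma (Re a + real n) * k powr (- (Re a + real n)) * exp (- (pi / 4 * \<bar>Im a + t\<bar>))"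
      using norm_Gamma_exp_le[of "a + \<i> * of_real t + of_nat n" "pi / 4"] a pi_gt_zero by (simp add: k_def)
    also have "\<dots> \<le> Gamma (Re a + real n) * k powr (- (Re a + real n)) * (exp (pi / 4 * \<bar>Im a\<bar>) * exp (- (pi / 4 * \<bar>t\<bar>)))"
    proof (rule mult_left_mono)
      have "pi / 4 * \<bar>t\<bar> \<le> pi / 4 * (\<bar>Im a + t\<bar> + \<bar>Im a\<bar>)"
        by (intro mult_left_mono) auto
      then show "exp (- (pi / 4 * \<bar>Im a + t\<bar>)) \<le> exp (pi / 4 * \<bar>Im a\<bar>) * exp (- (pi / 4 * \<bar>t\<bar>))"
        unfolding exp_add[symmetric] exp_le_cancel_iff by (simp add: distrib_left)
      show "0 \<le> Gamma (Re a + real n) * k powr (- (Re a + real n))"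
        using a by (intro mult_nonneg_nonneg) (auto intro!: less_imp_le Gamma_real_pos)
    qed
    also have "k powr (- (Re a + real n)) = k powr (- Re a) / k ^ n"
      using k by (simp add: powr_diff powr_realpow)
    finally have "norm (Gamma (a + \<i> * of_real t + of_nat n)) \<le> Gamma (Re a + real n) * (k powr (- Re a) / k ^ n) * (exp (pi / 4 * \<bar>Im a\<bar>) * exp (- (pi / 4 * \<bar>t\<bar>)))" .
    then have "norm (w\<^sup>2) ^ n / fact (2 * n) * norm (Gamma (a + \<i> * of_real t + of_nat n))
        \<le> norm (w\<^sup>2) ^ n / fact (2 * n) * (Gamma (Re a + real n) * (k powr (- Re a) / k ^ n) * (exp (pi / 4 * \<bar>Im a\<bar>) * exp (- (pi / 4 * \<bar>t\<bar>))))"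
      by (intro mult_left_mono) auto
    also have "\<dots> = P n * exp (- (pi / 4 * \<bar>t\<bar>))"
      by (simp add: P_def K_def power_divide mult_ac)
    finally show ?thesis
      unfolding gamma_1F1_term_def by (simp only: norm_mult norm_divide norm_power norm_minus_cancel norm_fact)
  qed
qed

lemma gamma_1F1_sums:
  assumes a: "Re a > 0"
  shows "gamma_1F1_term w a sums (Gamma a * hyp_1F1 a (1 / 2) (- (w\<^sup>2) / 4))"
proof -
  let ?h = "\<lambda>n. pochhammer a n * (- (w\<^sup>2) / 4) ^ n / (pochhammer (1 / 2) n * fact n)"
  obtain P where P: "summable P" "\<And>n t. norm (gamma_1F1_term w (a + \<i> * of_real t) n) \<le> P n * exp (- (pi / 4 * \<bar>t\<bar>))"
    using gamma_1F1_term_bound[OF a] by metis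
  have "summable (gamma_1F1_term w a)"
    by (rule summable_comparison_test'[OF P(1), of 0]) (use P(2)[of 0] in simp)
  moreover have nz: "a \<notin> \<int>\<^sub>\<le>\<^sub>0" by (rule not_nonpos_Int_if_Re_pos[OF a])
  have eq: "?h n = gamma_1F1_term w a n / Gamma a" for n
  proof -
    have G: "pochhammer a n = Gamma (a + of_nat n) / Gamma a" by (rule pochhammer_Gamma[OF nz])
    have F: "(fact (2 * n) :: complex) = 4 ^ n * (pochhammer (1 / 2) n * fact n)"
      using fact_double[of n, where 'a = complex] by (simp add: power_mult)
    show ?thesis unfolding gamma_1F1_term_def F G power_divide by (simp add: mult_ac)
  qed
  ultimately have "(\<lambda>n. gamma_1F1_term w a n / Gamma a) sums (suminf (gamma_1F1_term w a) / Gamma a)"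
    by (intro sums_divide summable_sums)
  then have "hyp_1F1 a (1 / 2) (- (w\<^sup>2) / 4) = suminf (gamma_1F1_term w a) / Gamma a"
    unfolding hyp_1F1_def eq by (rule sums_unique[symmetric])
  then have "Gamma a * hyp_1F1 a (1 / 2) (- (w\<^sup>2) / 4) = suminf (gamma_1F1_term w a)"
    using nz by (simp add: Gamma_eq_zero_iff)
  then show ?thesis using \<open>summable (gamma_1F1_term w a)\<close> by (simp add: summable_sums)
qed

text \<open>
  The common expansion of both sides: with \<open>X = (x / 2)\<^sup>2\<close> this is
  \<open>(- w\<^sup>2 x / 2) ^ (n + m) / ((2 n)! (2 m)!)\<close> times the Bessel function of order \<open>z + m - n\<close> at \<open>x\<close>.
\<close>

definition bessel_double_term :: "complex \<Rightarrow> complex \<Rightarrow> complex \<Rightarrow> nat \<Rightarrow> nat \<Rightarrow> complex" where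
  "bessel_double_term z w X n m = (- (w\<^sup>2)) ^ n / fact (2 * n) * ((- (w\<^sup>2)) ^ m / fact (2 * m))
     * (1 / 2 * X powr (of_nat n - z / 2) * macdonald_integral X (z + of_nat m - of_nat n))"

lemma gen_bessel_integrand_factors:
  assumes v: "Re v > 0" and c: "c > \<bar>Re z\<bar>"
  shows "gen_bessel_K_integrand z w (2 * v) (Complex c (2 * t))
    = (\<Sum>n. gamma_1F1_term w ((of_real c - z) / 2 + \<i> * of_real t) n)
      * (\<Sum>m. gamma_1F1_term w ((of_real c + z) / 2 + \<i> * of_real t) m)
      * (1 / 4 * v\<^sup>2 powr (- (of_real c / 2 + \<i> * of_real t)))"
proof -
  define s where "s = Complex c (2 * t)"
  have s: "s = of_real c + 2 * \<i> * of_real t" by (simp add: s_def complex_eq_iff)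
  have e: "(s - z) / 2 = (of_real c - z) / 2 + \<i> * of_real t" "(s + z) / 2 = (of_real c + z) / 2 + \<i> * of_real t"
    by (simp_all add: s field_simps)
  have r: "Re ((s - z) / 2) > 0" "Re ((s + z) / 2) > 0" using c by (auto simp: s)
  have "2 powr (s - 2) * (2 * v) powr (- s) = 1 / 4 * v powr (- s)"
  proof -
    have "(2 * v) powr (- s) = 2 powr (- s) * v powr (- s)"
      using powr_times_real_left[of 2 v "- s"] by simp
    moreover have "(2::complex) powr (s - 2) * 2 powr (- s) = 2 powr (- 2)"
      by (simp flip: powr_add)
    moreover have "(2::complex) powr (- 2) = 1 / 4"
      using powr_nat'[of "2::complex" 2] by (simp add: powr_minus inverse_eq_divide)
    ultimately show ?thesis by (simp only: mult.assoc[symmetric])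
  qed
  moreover have "v powr (- s) = v\<^sup>2 powr (- (of_real c / 2 + \<i> * of_real t))"
  proof -
    have "2 * - (of_real c / 2 + \<i> * of_real t) = - s" by (simp add: s algebra_simps)
    then show ?thesis unfolding power2_powr[OF v] by (simp only:)
  qed
  ultimately have p: "2 powr (s - 2) * (2 * v) powr (- s) = 1 / 4 * v\<^sup>2 powr (- (of_real c / 2 + \<i> * of_real t))"
    by simp
  have S: "(\<Sum>n. gamma_1F1_term w ((s - z) / 2) n) = Gamma ((s - z) / 2) * hyp_1F1 ((s - z) / 2) (1 / 2) (- (w\<^sup>2) / 4)"
    "(\<Sum>n. gamma_1F1_term w ((s + z) / 2) n) = Gamma ((s + z) / 2) * hyp_1F1 ((s + z) / 2) (1 / 2) (- (w\<^sup>2) / 4)"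
    using gamma_1F1_sums[OF r(1)] gamma_1F1_sums[OF r(2)] by (simp_all add: sums_iff)
  show ?thesis
    unfolding e[symmetric] S s_def[symmetric] gen_bessel_K_integrand_def p[symmetric] by (simp only: mult_ac)
qed

text \<open>
  Both confluent factors are expanded. The double series of integrands is dominated by a
  product of two convergent numerical series and one integrable function, so it may be
  integrated term by term, and each term is a Mellin-Barnes integral of Macdonald type. Writing
  \<open>s = c + 2 i t\<close> makes \<open>t\<close> the imaginary part of both Gamma arguments, up to a constant.
\<close>

theorem gen_bessel_K_double_series:
  assumes v: "Re v > 0" and X: "Re (v\<^sup>2) > 0" and c: "c > \<bar>Re z\<bar>"
  shows "integrable lborel (\<lambda>y. gen_bessel_K_integrand z w (2 * v) (Complex c y))"
    and "(\<lambda>n. \<Sum>m. bessel_double_term z w (v\<^sup>2) n m) sums gen_bessel_K c z w (2 * v)"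
proof -
  define X where "X = v\<^sup>2"
  have ReX: "Re X > 0" using X by (simp add: X_def)
  define a where "a = (of_real c - z) / 2"
  define b where "b = (of_real c + z) / 2"
  have a: "Re a > 0" and b: "Re b > 0" using c by (auto simp: a_def b_def)
  define A where "A = (\<lambda>n t. gamma_1F1_term w (a + \<i> * of_real t) n)"
  define B where "B = (\<lambda>n t. gamma_1F1_term w (b + \<i> * of_real t) n)"
  define g where "g = (\<lambda>t. 1 / 4 * X powr (- (of_real c / 2 + \<i> * of_real t)))"
  obtain P where P: "summable P" "\<And>n. P n \<ge> 0" "\<And>n t. norm (A n t) \<le> P n * exp (- (pi / 4 * \<bar>t\<bar>))"
    unfolding A_def using gamma_1F1_term_bound[OF a] by metis
  obtain Q where Q: "summable Q" "\<And>n. Q n \<ge> 0" "\<And>n t. norm (B n t) \<le> Q n * exp (- (pi / 4 * \<bar>t\<bar>))"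
    unfolding B_def using gamma_1F1_term_bound[OF b] by metis
  have shift: "e + \<i> * of_real t + of_nat n = (e + of_nat n) + \<i> * of_real t" for e t n by simp
  have Am [measurable]: "A n \<in> borel_measurable borel" for n
    unfolding A_def gamma_1F1_term_def shift using a by (intro borel_measurable_times borel_measurable_Gamma_line) auto
  have Bm [measurable]: "B n \<in> borel_measurable borel" for n
    unfolding B_def gamma_1F1_term_def shift using b by (intro borel_measurable_times borel_measurable_Gamma_line) auto
  have gm [measurable]: "g \<in> borel_measurable borel"
    unfolding g_def powr_def by measurable
  define th where "th = \<bar>Arg X\<bar>"
  have th: "th < pi / 2" using abs_Arg_less_pi_half[OF ReX] by (simp add: th_def)
  define C where "C = norm X powr (- (c / 2)) / 4"
  have gb: "norm (g t) \<le> C * exp (th * \<bar>t\<bar>)" for t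
  proof -
    have "norm (g t) = C * exp (t * Arg X)"
      using norm_powr_complex[of X "- (of_real c / 2 + \<i> * of_real t)"] by (simp add: g_def C_def norm_mult)
    also have "\<dots> \<le> C * exp (th * \<bar>t\<bar>)"
    proof -
      have "t * Arg X \<le> th * \<bar>t\<bar>" unfolding th_def by (metis abs_ge_self abs_mult mult.commute)
      then show ?thesis by (intro mult_left_mono) (auto simp: C_def)
    qed
    finally show ?thesis .
  qed
  define D where "D = (\<lambda>t. C * exp (- ((pi / 2 - th) * \<bar>t\<bar>)))"
  have D: "integrable lborel D"
    unfolding D_def using th by (intro integrable_mult_right integrable_exp_minus_abs) simp
  have Deq: "exp (- (pi / 4 * \<bar>t\<bar>)) * exp (- (pi / 4 * \<bar>t\<bar>)) * (C * exp (th * \<bar>t\<bar>)) = D t" for t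
  proof -
    have "exp (- (pi / 4 * \<bar>t\<bar>)) * exp (- (pi / 4 * \<bar>t\<bar>)) * exp (th * \<bar>t\<bar>) = exp (- ((pi / 2 - th) * \<bar>t\<bar>))"
      unfolding exp_add[symmetric] by (simp add: algebra_simps)
    then show ?thesis by (simp add: D_def mult_ac)
  qed
  have three: "norm (p * q * g t) \<le> M * N * D t"
    if "norm p \<le> M * exp (- (pi / 4 * \<bar>t\<bar>))" "norm q \<le> N * exp (- (pi / 4 * \<bar>t\<bar>))" "M \<ge> 0" "N \<ge> 0" for p q M N t
  proof -
    have "norm (p * q * g t) \<le> M * exp (- (pi / 4 * \<bar>t\<bar>)) * (N * exp (- (pi / 4 * \<bar>t\<bar>))) * (C * exp (th * \<bar>t\<bar>))"
      unfolding norm_mult using that gb by (intro mult_mono) auto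
    then show ?thesis unfolding Deq[symmetric] by (simp add: mult_ac)
  qed
  have Bsum: "norm (\<Sum>m. B m t) \<le> suminf Q * exp (- (pi / 4 * \<bar>t\<bar>))" and Bsummable: "summable (\<lambda>m. B m t)"
    and Asummable: "summable (\<lambda>n. A n t)" for t
  proof -
    have q: "summable (\<lambda>m. Q m * exp (- (pi / 4 * \<bar>t\<bar>)))" using Q(1) by (rule summable_mult2)
    have "norm (\<Sum>m. B m t) \<le> (\<Sum>m. Q m * exp (- (pi / 4 * \<bar>t\<bar>)))"
      by (rule norm_suminf_le[OF Q(3) q])
    then show "norm (\<Sum>m. B m t) \<le> suminf Q * exp (- (pi / 4 * \<bar>t\<bar>))"
      using suminf_mult2[OF Q(1)] by simp
    show "summable (\<lambda>m. B m t)" by (rule summable_comparison_test'[OF q, of 0]) (rule Q(3))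
    show "summable (\<lambda>n. A n t)"
      by (rule summable_comparison_test'[OF summable_mult2[OF P(1), of "exp (- (pi / 4 * \<bar>t\<bar>))"], of 0]) (rule P(3))
  qed
  define F where "F = (\<lambda>n t. A n t * (\<Sum>m. B m t) * g t)"
  have Fm: "F n \<in> borel_measurable lborel" for n unfolding F_def by measurable
  have Fb: "norm (F n t) \<le> P n * (suminf Q * D t)" for n t
    unfolding F_def using three[OF P(3) Bsum P(2) suminf_nonneg[OF Q(1,2)]] by (simp add: mult.assoc)
  define h where "h = (\<lambda>t. (\<Sum>n. A n t) * (\<Sum>m. B m t) * g t)"
  have hF: "(\<Sum>n. F n t) = h t" for t
    unfolding F_def h_def mult.assoc by (rule suminf_mult2[OF Asummable, symmetric])
  note outer = sums_integral_dominated[of F, OF Fm integrable_mult_right[OF D] P(1) Fb, unfolded hF]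
  have inner: "(\<lambda>m. of_real pi * bessel_double_term z w X n m) sums (LINT t|lborel. F n t)" for n
  proof -
    let ?G = "\<lambda>m t. A n t * B m t * g t"
    have Gm: "?G m \<in> borel_measurable lborel" for m by measurable
    have Gb: "norm (?G m t) \<le> Q m * (P n * D t)" for m t
      using three[OF P(3) Q(3) P(2) Q(2), of n t m] by (simp add: mult_ac)
    have "(\<Sum>m. ?G m t) = F n t" for t
      unfolding F_def using suminf_mult2[OF summable_mult[OF Bsummable], of "A n t" t "g t"] suminf_mult[OF Bsummable, of "A n t" t] by simp
    then have "(\<lambda>m. LINT t|lborel. ?G m t) sums (LINT t|lborel. F n t)"
      using sums_integral_dominated(2)[of ?G, OF Gm integrable_mult_right[OF D] Q(1) Gb] by simp
    moreover have "(LINT t|lborel. ?G m t) = of_real pi * bessel_double_term z w X n m" for m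
    proof -
      let ?k = "(- (w\<^sup>2)) ^ n / fact (2 * n) * ((- (w\<^sup>2)) ^ m / fact (2 * m)) * (1 / 4 * X powr (of_nat n - z / 2))"
      define al where "al = a + of_nat n"
      define be where "be = b + of_nat m"
      have al: "Re al > 0" and be: "Re be > 0" using a b by (auto simp: al_def be_def)
      have "?G m t = ?k * (Gamma (al + \<i> * of_real t) * Gamma (be + \<i> * of_real t) * X powr (- (al + \<i> * of_real t)))" for t
      proof -
        \<comment> \<open>The power of \<open>X\<close> must carry the exponent of the first Gamma factor.\<close>
        have "- (of_real c / 2 + \<i> * of_real t) = (of_nat n - z / 2) + - (al + \<i> * of_real t)"
          by (simp add: al_def a_def field_simps)
        then have "X powr (- (of_real c / 2 + \<i> * of_real t)) = X powr (of_nat n - z / 2) * X powr (- (al + \<i> * of_real t))"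
          by (simp only: powr_add)
        moreover have "a + \<i> * of_real t + of_nat n = al + \<i> * of_real t" "b + \<i> * of_real t + of_nat m = be + \<i> * of_real t"
          by (simp_all add: al_def be_def)
        ultimately show ?thesis
          unfolding A_def B_def g_def gamma_1F1_term_def by (simp only: mult_ac)
      qed
      then have "(LINT t|lborel. ?G m t) = ?k * (2 * of_real pi * macdonald_integral X (be - al))"
        unfolding Mellin_Barnes_macdonald[OF al be ReX, symmetric] by (simp only: integral_mult_right_zero)
      also have "be - al = z + of_nat m - of_nat n" by (simp add: al_def be_def a_def b_def field_simps)
      finally show ?thesis unfolding bessel_double_term_def by (simp add: mult_ac)
    qed
    ultimately show ?thesis by simp
  qed
  have hI: "gen_bessel_K_integrand z w (2 * v) (Complex c (0 + 2 * t)) = h t" for t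
    using gen_bessel_integrand_factors[OF v c, of w t] by (simp add: h_def A_def B_def g_def a_def b_def X_def)
  have "integrable lborel (\<lambda>t. gen_bessel_K_integrand z w (2 * v) (Complex c (0 + 2 * t)))"
    unfolding hI by (rule outer(1))
  then show "integrable lborel (\<lambda>y. gen_bessel_K_integrand z w (2 * v) (Complex c y))"
    by (subst (asm) lborel_integrable_real_affine_iff) auto
  have "gen_bessel_K c z w (2 * v) = 1 / (2 * of_real pi) * (LINT y|lborel. gen_bessel_K_integrand z w (2 * v) (Complex c y))"
    unfolding gen_bessel_K_def by simp
  also have "(LINT y|lborel. gen_bessel_K_integrand z w (2 * v) (Complex c y)) = 2 * (LINT t|lborel. h t)"
    using lborel_integral_real_affine[of 2 "\<lambda>y. gen_bessel_K_integrand z w (2 * v) (Complex c y)" 0] unfolding hI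
    by (simp add: scaleR_conv_of_real)
  finally have K: "gen_bessel_K c z w (2 * v) = (LINT t|lborel. h t) / of_real pi"
    by simp
  have "(LINT t|lborel. F n t) / of_real pi = (\<Sum>m. bessel_double_term z w X n m)" for n
    using sums_divide[OF inner[of n], of "of_real pi"] by (simp add: sums_iff)
  then show "(\<lambda>n. \<Sum>m. bessel_double_term z w (v\<^sup>2) n m) sums gen_bessel_K c z w (2 * v)"
    using sums_divide[OF outer(2), of "of_real pi"] unfolding K X_def by simp
qed


section \<open>The series of integrals\<close>

text \<open>
  The reciprocal of this bound cancels the Gamma factor that comes from integrating
  absolute values.
\<close>

lemma norm_pochhammer_ge:
  fixes b :: complex
  assumes b: "Re b > 0"
  shows "pochhammer (Re b) m \<le> norm (pochhammer b m)"
proof (induction m)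
  case (Suc m)
  have "Re b + real m \<le> norm (b + of_nat m)"
    using complex_Re_le_cmod[of "b + of_nat m"] by simp
  moreover have "0 \<le> Re b + real m" using b by simp
  ultimately show ?case
    unfolding pochhammer_Suc norm_mult using Suc b by (intro mult_mono) auto
qed simp

lemma hyp_0F2_half_summable:
  assumes b: "Re b > 0"
  shows "summable (\<lambda>n. norm (u ^ n / (pochhammer (1 / 2) n * pochhammer b n * fact n)))"
proof -
  obtain N :: nat where N: "real N > 1 + 4 * norm u" using reals_Archimedean2 by blast
  let ?T = "\<lambda>n. norm (u ^ n / (pochhammer (1 / 2) n * pochhammer b n * fact n))"
  show ?thesis
  proof (rule summable_ratio_test[of "1 / 2" N])
    fix n assume "n \<ge> N"
    then have n: "real n > 1 + 4 * norm u" using N by linarith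
    have "real n \<le> Re (b + of_nat n)" using b by simp
    also have "\<dots> \<le> norm (b + of_nat n)" by (rule complex_Re_le_cmod)
    finally have b1: "norm (b + of_nat n) \<ge> 1" using n norm_ge_zero[of u] by linarith
    have "norm (1 / 2 + of_nat n :: complex) \<ge> Re (1 / 2 + of_nat n)" by (rule complex_Re_le_cmod)
    then have h1: "norm (1 / 2 + of_nat n :: complex) \<ge> 1 / 2" by simp
    have "(1 / 2) * 1 * (4 * norm u) \<le> norm (1 / 2 + of_nat n :: complex) * norm (b + of_nat n) * (real n + 1)"
      using b1 h1 n norm_ge_zero[of u] by (intro mult_mono) auto
    then have le: "norm u / (norm (1 / 2 + of_nat n :: complex) * norm (b + of_nat n) * (real n + 1)) \<le> 1 / 2"
      using b1 h1 n norm_ge_zero[of u] by (subst pos_divide_le_eq) (auto intro!: mult_pos_pos)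
    have "norm (fact (Suc n) :: complex) = (real n + 1) * fact n"
      unfolding norm_fact by (simp add: fact_Suc add.commute)
    then have "?T (Suc n) = norm u / (norm (1 / 2 + of_nat n :: complex) * norm (b + of_nat n) * (real n + 1)) * ?T n"
      unfolding pochhammer_Suc norm_divide norm_mult norm_power by (simp add: norm_fact)
    also have "\<dots> \<le> 1 / 2 * ?T n"
      by (rule mult_right_mono[OF le norm_ge_zero])
    finally show "norm (?T (Suc n)) \<le> 1 / 2 * norm (?T n)" by simp
  qed simp
qed

text \<open>
  All powers of \<open>x = 2 v\<close> that arise on the series side: the prefactor, the powers from the \<open>t\<close>
  integral, and those from the Bessel function of order \<open>n + 1 / 2\<close>. The powers of two cancel.
\<close>

lemma powr_prefactor:
  assumes v: "Re v > 0"
  shows "(4 * v) powr (z + 1 / 2) * (2 * v) powr (- (2 * z + 1)) * v powr (of_nat n + 1 / 2) * v ^ n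
    = (v\<^sup>2) powr (of_nat n - z / 2)"
proof -
  have v0: "v \<noteq> 0" using v by auto
  have "Ln 4 = complex_of_real (ln (2 ^ 2))" using Ln_of_real[of 4] by simp
  also have "ln ((2::real) ^ 2) = 2 * ln 2" by (subst ln_realpow) auto
  finally have L4: "Ln 4 = 2 * complex_of_real (ln 2)" by simp
  have L2: "Ln 2 = complex_of_real (ln 2)" using Ln_of_real[of 2] by simp
  have L: "Ln (4 * v) = 2 * of_real (ln 2) + Ln v" "Ln (2 * v) = of_real (ln 2) + Ln v"
    using Ln_times_of_real[of 4 v] Ln_times_of_real[of 2 v] v0 L4 L2 by simp_all
  have "v ^ n = v powr of_nat n" using v0 by simp
  then have "(4 * v) powr (z + 1 / 2) * (2 * v) powr (- (2 * z + 1)) * v powr (of_nat n + 1 / 2) * v ^ n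
    = exp ((z + 1 / 2) * (2 * of_real (ln 2) + Ln v) + - (2 * z + 1) * (of_real (ln 2) + Ln v) + (of_nat n + 1 / 2) * Ln v + of_nat n * Ln v)"
    using v0 by (simp only: powr_def L exp_add mult_eq_0_iff if_False) simp
  also have "\<dots> = exp (2 * (of_nat n - z / 2) * Ln v)"
    by (rule arg_cong[where f = exp]) (simp add: algebra_simps)
  also have "\<dots> = (v\<^sup>2) powr (of_nat n - z / 2)"
    unfolding power2_powr[OF v] using v0 by (simp add: powr_def)
  finally show ?thesis .
qed

text \<open>
  With \<open>p = t (t + 1)\<close> the integrand is \<open>(2 t + 1)\<close> times \<open>p powr (z - 1 / 2)\<close> times a Macdonald
  integral at \<open>X (2 t + 1)\<^sup>2\<close> times a power series in \<open>p\<close>: the factor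
  \<open>(2 t + 1) powr (1 / 2 - n)\<close> cancels all but one power of \<open>2 t + 1\<close> from the Bessel function.
  Each power of \<open>p\<close> is integrated separately; its Gamma factor \<open>Gamma (z + 1 / 2 + m)\<close> cancels the
  rising factorial of \<open>z + 1 / 2\<close> in the hypergeometric coefficient up to \<open>Gamma (z + 1 / 2)\<close>, which
  is the one in the prefactor.
\<close>

theorem bessel_K_series_integral:
  fixes z w v :: complex and n :: nat
  assumes z: "Re z > - 1 / 2" and v: "Re v > 0" and ReX: "Re (v\<^sup>2) > 0"
  defines "f \<equiv> \<lambda>t::real.
      of_real t powr (z - 1 / 2) * of_real (t + 1) powr (z - 1 / 2)
      * of_real (2 * t + 1) powr (- of_nat n + 1 / 2)
      * bessel_K (of_nat n + 1 / 2) (2 * v * of_real (2 * t + 1))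
      * hyp_0F2 (1 / 2) (1 / 2 + z) (- (w\<^sup>2 * (2 * v)\<^sup>2 * of_real t * of_real (t + 1)) / 4)"
  shows "set_integrable lborel {0<..} f"
    and "(\<lambda>m. bessel_double_term z w (v\<^sup>2) n m) sums
      ((2 * (2 * v)) powr (z + 1 / 2) / Gamma (z + 1 / 2) * ((- (w\<^sup>2 * (2 * v)) / 2) ^ n / fact (2 * n) * (LINT t:{0<..}|lborel. f t)))"
proof -
  define X where "X = v\<^sup>2"
  define b where "b = z + 1 / 2"
  define \<nu> where "\<nu> = complex_of_nat n + 1 / 2"
  define R where "R = Re X"
  have v0: "v \<noteq> 0" using v by auto
  have RX: "R > 0" "Re X > 0" using ReX by (auto simp: R_def X_def)
  have b: "Re b > 0" using z by (simp add: b_def)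
  have bm: "Re (b + of_nat m) > 0" for m using b by simp
  have nzb: "b \<notin> \<int>\<^sub>\<le>\<^sub>0" by (rule not_nonpos_Int_if_Re_pos[OF b])
  have Gb: "Gamma b \<noteq> 0" using nzb by (simp add: Gamma_eq_zero_iff)
  have Gbm: "Gamma (b + of_nat m) = pochhammer b m * Gamma b" for m
    using pochhammer_Gamma[OF nzb, of m] Gb by simp
  have pb: "pochhammer b m \<noteq> 0" for m
    using Gbm[of m] not_nonpos_Int_if_Re_pos[OF bm, of m] by (auto simp: Gamma_eq_zero_iff)
  define k where "k = (\<lambda>m. (- (w\<^sup>2 * (2 * v)\<^sup>2)) ^ m / (fact (2 * m) * pochhammer b m))"
  define g where "g = (\<lambda>m t. of_real (2 * t + 1) * of_real (t * (t + 1)) powr (b + of_nat m - 1) * macdonald_integral (X * of_real ((2 * t + 1)\<^sup>2)) (- \<nu>))"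
  define E where "E = (\<lambda>m t. k m * (1 / 2 * v powr \<nu>) * g m t)"
  have G: "set_integrable lborel {0<..} (g m)"
    "(LINT t:{0<..}|lborel. g m t) = Gamma (b + of_nat m) * (4 * X) powr (- (b + of_nat m)) * macdonald_integral X (- \<nu> + (b + of_nat m))"
    "(LINT t:{0<..}|lborel. norm (g m t)) \<le> Gamma (Re (b + of_nat m)) * (4 * Re X) powr (- Re (b + of_nat m))
      * (LINT u:{0<..}|lborel. exp (- (1 * u) - Re X / u) * u powr (Re (- \<nu>) + Re (b + of_nat m) - 1))" for m
    unfolding g_def by (rule macdonald_shifted_square_integral[OF RX(2) bm])+
  \<comment> \<open>The powers of \<open>2 t + 1\<close> combine to exponent one, because \<open>- n + 1 / 2 + \<nu> = 1\<close>.\<close>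
  have kern: "of_real t powr (z - 1 / 2) * of_real (t + 1) powr (z - 1 / 2) * of_real (2 * t + 1) powr (- of_nat n + 1 / 2)
      * bessel_K (of_nat n + 1 / 2) (2 * v * of_real (2 * t + 1)) = 1 / 2 * v powr \<nu> * g 0 t" if t: "t > 0" for t :: real
  proof -
    let ?r = "2 * t + 1"
    have r: "?r > 0" using t by simp
    have "Re (2 * v * of_real ?r) > 0" using v r by simp
    moreover have h: "2 * v * of_real ?r / 2 = of_real ?r * v" by simp
    have q: "(of_real ?r * v)\<^sup>2 = X * of_real (?r\<^sup>2)" by (simp add: X_def power_mult_distrib)
    moreover have "Re (X * of_real (?r\<^sup>2)) > 0" using RX r by (simp del: of_real_power)
    ultimately have K: "bessel_K (of_nat n + 1 / 2) (2 * v * of_real ?r) = 1 / 2 * (of_real ?r * v) powr \<nu> * macdonald_integral (X * of_real (?r\<^sup>2)) (- \<nu>)"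
      using bessel_K_half_integer[of "2 * v * of_real ?r" n] unfolding h \<nu>_def by simp
    have P: "(of_real ?r * v) powr \<nu> = of_real ?r powr \<nu> * v powr \<nu>"
      using r by (intro powr_times_real_left) auto
    have O: "of_real ?r powr (- of_nat n + 1 / 2) * of_real ?r powr \<nu> = complex_of_real ?r"
    proof -
      have "- of_nat n + 1 / 2 + \<nu> = 1" by (simp add: \<nu>_def)
      then show ?thesis using r by (simp only: powr_add[symmetric]) simp
    qed
    have T: "complex_of_real t powr (z - 1 / 2) * of_real (t + 1) powr (z - 1 / 2) = of_real (t * (t + 1)) powr (b - 1)"
      using powr_times_real_left[of "of_real t" "of_real (t + 1)" "z - 1 / 2"] t by (simp add: b_def)
    have g0: "g 0 t = of_real ?r * of_real (t * (t + 1)) powr (b - 1) * macdonald_integral (X * of_real (?r\<^sup>2)) (- \<nu>)"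
      by (simp add: g_def)
    have "y * p * (1 / 2 * (q * s) * M) = 1 / 2 * s * (r * y * M)" if "p * q = r" for y p q r s M :: complex
      unfolding that[symmetric] by (simp only: mult_ac)
    then show ?thesis unfolding K P T g0 using O .
  qed
  have Esums: "(\<lambda>m. E m t) sums f t" and Enorm: "summable (\<lambda>m. norm (E m t))" if t: "t > 0" for t :: real
  proof -
    define p where "p = complex_of_real (t * (t + 1))"
    have p0: "p \<noteq> 0" using t unfolding p_def of_real_eq_0_iff by simp
    let ?u = "- (w\<^sup>2 * (2 * v)\<^sup>2 * of_real t * of_real (t + 1)) / 4"
    let ?T = "\<lambda>m. ?u ^ m / (pochhammer (1 / 2) m * pochhammer b m * fact m)"
    have T: "summable (\<lambda>m. norm (?T m))" by (rule hyp_0F2_half_summable[OF b])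
    have Tk: "?T m = k m * p ^ m" for m
    proof -
      have F: "(fact (2 * m) :: complex) = 4 ^ m * (pochhammer (1 / 2) m * fact m)"
        using fact_double[of m, where 'a = complex] by (simp add: power_mult)
      have "?u = - (w\<^sup>2 * (2 * v)\<^sup>2) * p / 4" by (simp add: p_def)
      then have U: "?u ^ m = (- (w\<^sup>2 * (2 * v)\<^sup>2)) ^ m * p ^ m / 4 ^ m" by (simp only: power_divide power_mult_distrib)
      show ?thesis unfolding k_def F U by (simp only: divide_inverse inverse_mult_distrib mult_ac)
    qed
    have gm: "g m t = g 0 t * p ^ m" for m
    proof -
      have "p powr (b + of_nat m - 1) = p powr (b - 1) * p ^ m"
        using powr_add_of_nat[OF p0, of "b - 1" m] by (simp add: algebra_simps)
      then show ?thesis unfolding g_def p_def[symmetric] by (simp add: mult_ac)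
    qed
    have "E m t = k m * (1 / 2 * v powr \<nu>) * (g 0 t * p ^ m)" for m
      unfolding E_def by (subst gm) (rule refl)
    then have ET: "E m t = 1 / 2 * v powr \<nu> * g 0 t * ?T m" for m
      unfolding Tk by (simp only: mult_ac)
    have "(\<lambda>m. 1 / 2 * v powr \<nu> * g 0 t * ?T m) sums (1 / 2 * v powr \<nu> * g 0 t * suminf ?T)"
      by (intro sums_mult summable_sums summable_norm_cancel[OF T])
    moreover have "1 / 2 * v powr \<nu> * g 0 t * suminf ?T = f t"
      unfolding f_def kern[OF t] hyp_0F2_def b_def by (simp only: add.commute[of "1 / 2" z])
    ultimately show "(\<lambda>m. E m t) sums f t" by (simp only: ET)
    have "norm (E m t) = norm (1 / 2 * v powr \<nu> * g 0 t) * norm (?T m)" for m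
      by (simp only: ET norm_mult[of "1 / 2 * v powr \<nu> * g 0 t"])
    then show "summable (\<lambda>m. norm (E m t))"
      using summable_mult[OF T, of "norm (1 / 2 * v powr \<nu> * g 0 t)"] by (simp only:)
  qed
  let ?I = "\<lambda>m t. indicat_real {0<..} t *\<^sub>R E m t"
  have Eint: "integrable lborel (?I m)" for m
    using G(1)[of m] unfolding E_def set_integrable_def[symmetric] by (rule set_integrable_mult_right)
  define M where "M = (LINT u:{0<..}|lborel. exp (- ((1 / 2) * u) - R / u) * u powr (Re z - real n - 1))"
  define C where "C = norm (1 / 2 * v powr \<nu>) * (Gamma (Re b) * (4 * R) powr (- Re b) * M)"
  define q where "q = norm (w\<^sup>2 * (2 * v)\<^sup>2) * 2 / (4 * R)"
  have M0: "M \<ge> 0" unfolding M_def set_lebesgue_integral_def by (intro integral_nonneg_AE AE_I2) (auto simp: indicator_def)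
  have Ebound: "(LINT t|lborel. norm (?I m t)) \<le> C * (q ^ m * Gamma (1 + real m) / fact (2 * m))" for m
  proof -
    have "(LINT t|lborel. norm (?I m t)) = norm (k m) * norm (1 / 2 * v powr \<nu>) * (LINT t:{0<..}|lborel. norm (g m t))"
    proof -
      have "norm (?I m t) = norm (k m) * norm (1 / 2 * v powr \<nu>) * (indicat_real {0<..} t *\<^sub>R norm (g m t))" for t
        unfolding E_def norm_scaleR norm_mult by (simp add: indicator_def)
      then show ?thesis unfolding set_lebesgue_integral_def by (simp only: integral_mult_right_zero)
    qed
    also have "\<dots> \<le> norm (k m) * norm (1 / 2 * v powr \<nu>) * (Gamma (Re b + real m) * (4 * R) powr (- (Re b + real m)) * (fact m * 2 ^ m * M))"
    proof (intro mult_left_mono)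
      have "Re (- \<nu>) + Re (b + of_nat m) - 1 = Re z - real n - 1 + real m"
        by (simp add: \<nu>_def b_def)
      then have "(LINT t:{0<..}|lborel. norm (g m t)) \<le> Gamma (Re b + real m) * (4 * R) powr (- (Re b + real m)) *
          (LINT u:{0<..}|lborel. exp (- (1 * u) - R / u) * u powr (Re z - real n - 1 + real m))"
        using G(3)[of m] unfolding R_def[symmetric] by (simp only: plus_complex.sel complex_Re_of_nat)
      also have "\<dots> \<le> Gamma (Re b + real m) * (4 * R) powr (- (Re b + real m)) * (fact m * 2 ^ m * M)"
        unfolding M_def by (intro mult_left_mono macdonald_real_moment_bound RX mult_nonneg_nonneg)
          (use b in \<open>auto intro!: less_imp_le Gamma_real_pos\<close>)
      finally show "(LINT t:{0<..}|lborel. norm (g m t)) \<le> Gamma (Re b + real m) * (4 * R) powr (- (Re b + real m)) * (fact m * 2 ^ m * M)" .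
    qed auto
    also have "\<dots> = (norm (k m) * Gamma (Re b + real m)) * (norm (1 / 2 * v powr \<nu>) * ((4 * R) powr (- (Re b + real m)) * (fact m * 2 ^ m * M)))"
      by (simp only: mult_ac)
    also have "\<dots> \<le> (norm (w\<^sup>2 * (2 * v)\<^sup>2) ^ m / fact (2 * m) * Gamma (Re b)) * (norm (1 / 2 * v powr \<nu>) * ((4 * R) powr (- (Re b + real m)) * (fact m * 2 ^ m * M)))"
    proof (rule mult_right_mono)
      have nb: "Re b \<notin> \<int>\<^sub>\<le>\<^sub>0" using b by (auto simp: nonpos_Ints_def)
      have Gp: "Gamma (Re b) > 0" using b by (rule Gamma_real_pos)
      have "Gamma (Re b + real m) = pochhammer (Re b) m * Gamma (Re b)"
        using pochhammer_Gamma[OF nb, of m] Gp by simp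
      also have "\<dots> \<le> norm (pochhammer b m) * Gamma (Re b)"
        using norm_pochhammer_ge[OF b, of m] Gp by (intro mult_right_mono) auto
      finally have "norm (k m) * Gamma (Re b + real m) \<le> norm (k m) * (norm (pochhammer b m) * Gamma (Re b))"
        by (rule mult_left_mono) simp
      also have "norm (k m) * (norm (pochhammer b m) * Gamma (Re b)) = norm (k m * pochhammer b m) * Gamma (Re b)"
        by (simp only: norm_mult mult.assoc)
      also have "k m * pochhammer b m = (- (w\<^sup>2 * (2 * v)\<^sup>2)) ^ m / fact (2 * m)"
        unfolding k_def using pb by simp
      finally show "norm (k m) * Gamma (Re b + real m) \<le> norm (w\<^sup>2 * (2 * v)\<^sup>2) ^ m / fact (2 * m) * Gamma (Re b)"
        by (simp only: norm_divide norm_power norm_minus_cancel norm_fact)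
      show "0 \<le> norm (1 / 2 * v powr \<nu>) * ((4 * R) powr (- (Re b + real m)) * (fact m * 2 ^ m * M))"
        using M0 by (intro mult_nonneg_nonneg) auto
    qed
    also have "\<dots> = C * (q ^ m * Gamma (1 + real m) / fact (2 * m))"
    proof -
      have "(4 * R) powr (- (Re b + real m)) = (4 * R) powr (- Re b) / (4 * R) ^ m"
        using RX powr_realpow[of "4 * R" m] by (simp add: powr_diff)
      moreover have "Gamma (1 + real m) = fact m" by (rule Gamma_fact)
      ultimately show ?thesis
        unfolding C_def q_def by (simp only: power_divide power_mult_distrib) (simp only: divide_inverse mult_ac)
    qed
    finally show ?thesis .
  qed
  have Ssum: "summable (\<lambda>m. LINT t|lborel. norm (?I m t))"
  proof (rule summable_comparison_test'[of _ 0])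
    show "summable (\<lambda>m. C * (q ^ m * Gamma (1 + real m) / fact (2 * m)))"
      using RX by (intro summable_mult summable_Gamma_over_fact_double) (auto simp: q_def)
    show "norm (LINT t|lborel. norm (?I m t)) \<le> C * (q ^ m * Gamma (1 + real m) / fact (2 * m))" for m
      using Ebound[of m] by simp
  qed
  have AE: "AE t in lborel. summable (\<lambda>m. norm (?I m t))"
  proof (rule AE_I2)
    fix t show "summable (\<lambda>m. norm (?I m t))"
      using Enorm[of t] by (cases "t > 0") auto
  qed
  have fI: "(\<Sum>m. ?I m t) = indicat_real {0<..} t *\<^sub>R f t" for t
    using Esums[of t] by (cases "t > 0") (auto simp: sums_iff)
  show "set_integrable lborel {0<..} f"
    using integrable_suminf[OF Eint AE Ssum] unfolding fI set_integrable_def .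
  have "(\<lambda>m. LINT t|lborel. ?I m t) sums (LINT t:{0<..}|lborel. f t)"
    using sums_integral[OF Eint AE Ssum] unfolding fI set_lebesgue_integral_def .
  from sums_mult[OF this, of "(2 * (2 * v)) powr b / Gamma b * ((- (w\<^sup>2 * (2 * v)) / 2) ^ n / fact (2 * n))"]
  have "(\<lambda>m. (2 * (2 * v)) powr b / Gamma b * ((- (w\<^sup>2 * (2 * v)) / 2) ^ n / fact (2 * n)) * (LINT t|lborel. ?I m t))
     sums ((2 * (2 * v)) powr b / Gamma b * ((- (w\<^sup>2 * (2 * v)) / 2) ^ n / fact (2 * n)) * (LINT t:{0<..}|lborel. f t))" .
  moreover have "(2 * (2 * v)) powr b / Gamma b * ((- (w\<^sup>2 * (2 * v)) / 2) ^ n / fact (2 * n)) * (LINT t|lborel. ?I m t)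
     = bessel_double_term z w X n m" for m
  proof -
    have "(LINT t|lborel. ?I m t) = k m * (1 / 2 * v powr \<nu>) * (LINT t:{0<..}|lborel. g m t)"
      unfolding E_def set_lebesgue_integral_def by (simp only: mult_scaleR_right[symmetric] integral_mult_right_zero)
    also have "\<dots> = k m * (1 / 2 * v powr \<nu>) * (Gamma (b + of_nat m) * (4 * X) powr (- (b + of_nat m)) * macdonald_integral X (- \<nu> + (b + of_nat m)))"
      unfolding G(2) ..
    also have "- \<nu> + (b + of_nat m) = z + of_nat m - of_nat n" by (simp add: \<nu>_def b_def)
    also have "(4 * X) powr (- (b + of_nat m)) = (2 * v) powr (- (2 * z + 1)) / ((2 * v)\<^sup>2) ^ m"
    proof -
      have "4 * X = (2 * v)\<^sup>2" by (simp add: X_def power_mult_distrib)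
      then have "(4 * X) powr (- (b + of_nat m)) = ((2 * v)\<^sup>2) powr (- b - of_nat m)" by simp
      also have "\<dots> = ((2 * v)\<^sup>2) powr (- b) / ((2 * v)\<^sup>2) ^ m"
        using v0 by (simp add: powr_diff)
      also have "((2 * v)\<^sup>2) powr (- b) = (2 * v) powr (2 * - b)"
        using v by (intro power2_powr) simp
      also have "2 * - b = - (2 * z + 1)" by (simp add: b_def)
      finally show ?thesis .
    qed
    also have "k m * (1 / 2 * v powr \<nu>) * (Gamma (b + of_nat m) * ((2 * v) powr (- (2 * z + 1)) / ((2 * v)\<^sup>2) ^ m) * macdonald_integral X (z + of_nat m - of_nat n))
       = (- (w\<^sup>2)) ^ m / fact (2 * m) * Gamma b * (1 / 2 * v powr \<nu> * (2 * v) powr (- (2 * z + 1)) * macdonald_integral X (z + of_nat m - of_nat n))"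
    proof -
      have "k m * Gamma (b + of_nat m) / ((2 * v)\<^sup>2) ^ m = (- (w\<^sup>2)) ^ m / fact (2 * m) * Gamma b"
      proof -
        have "(- (w\<^sup>2 * (2 * v)\<^sup>2)) ^ m = (- (w\<^sup>2)) ^ m * ((2 * v)\<^sup>2) ^ m"
          by (simp only: power_mult_distrib[symmetric] mult_minus_left)
        then show ?thesis unfolding k_def Gbm using pb[of m] v0 by simp
      qed
      moreover have "K * H * (G * (y / d) * M) = K * G / d * (H * y * M)" for K H G y d M :: complex
        by (simp only: divide_inverse mult_ac)
      ultimately show ?thesis by (simp only:)
    qed
    finally have I: "(LINT t|lborel. ?I m t) = (- (w\<^sup>2)) ^ m / fact (2 * m) * Gamma b * (1 / 2 * v powr \<nu> * (2 * v) powr (- (2 * z + 1)) * macdonald_integral X (z + of_nat m - of_nat n))" .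
    have "- (w\<^sup>2 * (2 * v)) / 2 = - (w\<^sup>2) * v" by simp
    then have W: "(- (w\<^sup>2 * (2 * v)) / 2) ^ n = (- (w\<^sup>2)) ^ n * v ^ n" by (simp only: power_mult_distrib)
    have PA: "(4 * v) powr b * (2 * v) powr (- (2 * z + 1)) * v powr \<nu> * v ^ n = X powr (of_nat n - z / 2)"
      unfolding b_def \<nu>_def X_def by (rule powr_prefactor[OF v])
    have "(2 * (2 * v)) powr b / Gamma b * ((- (w\<^sup>2 * (2 * v)) / 2) ^ n / fact (2 * n)) * (LINT t|lborel. ?I m t)
       = (- (w\<^sup>2)) ^ n / fact (2 * n) * ((- (w\<^sup>2)) ^ m / fact (2 * m)) * (1 / 2 * ((4 * v) powr b * (2 * v) powr (- (2 * z + 1)) * v powr \<nu> * v ^ n) * macdonald_integral X (z + of_nat m - of_nat n))"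
      unfolding I W using Gb by (simp add: mult_ac)
    then show ?thesis unfolding PA bessel_double_term_def .
  qed
  ultimately show "(\<lambda>m. bessel_double_term z w (v\<^sup>2) n m) sums
      ((2 * (2 * v)) powr (z + 1 / 2) / Gamma (z + 1 / 2) * ((- (w\<^sup>2 * (2 * v)) / 2) ^ n / fact (2 * n) * (LINT t:{0<..}|lborel. f t)))"
    unfolding X_def b_def by (simp only: mult.assoc)
qed

lemma Re_pos_if_abs_Arg_less:
  assumes "x \<noteq> 0" "\<bar>Arg x\<bar> < pi / 4"
  shows "Re x > 0" and "Re (x\<^sup>2) > 0"
proof -
  have x: "x = rcis (norm x) (Arg x)" by (simp add: rcis_cmod_Arg)
  have "Re x = norm x * cos (Arg x)" by (subst x) simp
  also have "\<dots> > 0" using assms by (intro mult_pos_pos cos_gt_zero_pi) auto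
  finally show "Re x > 0" .
  have "x\<^sup>2 = rcis ((norm x)\<^sup>2) (2 * Arg x)" by (subst x) (simp add: power2_eq_square rcis_mult)
  then have "Re (x\<^sup>2) = (norm x)\<^sup>2 * cos (2 * Arg x)" by simp
  also have "\<dots> > 0" using assms by (intro mult_pos_pos cos_gt_zero_pi) auto
  finally show "Re (x\<^sup>2) > 0" .
qed

theorem theorem1p10:
  fixes z w x :: complex and c :: real
  assumes "Re z > - 1 / 2"
    and "x \<noteq> 0" and "\<bar>Arg x\<bar> < pi / 4"
    and "c > \<bar>Re z\<bar>"
  defines "f \<equiv> \<lambda>(n::nat) (t::real).
      of_real t powr (z - 1 / 2) * of_real (t + 1) powr (z - 1 / 2)
      * of_real (2 * t + 1) powr (- of_nat n + 1 / 2)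
      * bessel_K (of_nat n + 1 / 2) (x * of_real (2 * t + 1))
      * hyp_0F2 (1 / 2) (1 / 2 + z) (- (w\<^sup>2 * x\<^sup>2 * of_real t * of_real (t + 1)) / 4)"
  defines "a \<equiv> \<lambda>n::nat.
      (- (w\<^sup>2 * x) / 2) ^ n / fact (2 * n) * (LINT t:{0<..}|lborel. f n t)"
  shows "integrable lborel (\<lambda>y. gen_bessel_K_integrand z w x (Complex c y))
    \<and> (\<forall>n. set_integrable lborel {0<..} (f n))
    \<and> summable a
    \<and> gen_bessel_K c z w x = (2 * x) powr (z + 1 / 2) / Gamma (z + 1 / 2) * (\<Sum>n. a n)"
proof -
  define v where "v = x / 2"
  have x: "x = 2 * v" by (simp add: v_def)
  have v: "Re v > 0" and X: "Re (v\<^sup>2) > 0"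
    using Re_pos_if_abs_Arg_less[OF assms(2,3)] by (simp_all add: v_def power_divide)
  define C where "C = (2 * x) powr (z + 1 / 2) / Gamma (z + 1 / 2)"
  have "z + 1 / 2 \<notin> \<int>\<^sub>\<le>\<^sub>0" using assms(1) by (intro not_nonpos_Int_if_Re_pos) simp
  then have C0: "C \<noteq> 0" using assms(2) by (simp add: C_def Gamma_eq_zero_iff)
  note S = bessel_K_series_integral[OF assms(1) v X, where w = w, folded x]
  note D = gen_bessel_K_double_series[OF v X assms(4), where w = w, folded x]
  have f: "set_integrable lborel {0<..} (f n)" for n
    unfolding f_def by (rule S(1))
  have "(\<lambda>m. bessel_double_term z w (v\<^sup>2) n m) sums (C * a n)" for n
    unfolding a_def f_def C_def by (rule S(2))
  then have "(\<Sum>m. bessel_double_term z w (v\<^sup>2) n m) = C * a n" for n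
    by (simp add: sums_iff)
  then have "(\<lambda>n. C * a n) sums gen_bessel_K c z w x"
    using D(2) by simp
  then have "a sums (gen_bessel_K c z w x / C)"
    using sums_mult_iff[OF C0, of a "gen_bessel_K c z w x / C"] C0 by simp
  then have "summable a" and "gen_bessel_K c z w x = C * (\<Sum>n. a n)"
    using C0 by (auto simp: sums_iff)
  then show ?thesis
    using D(1) f unfolding C_def by blast
qed

end
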